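(* Let $\delta$ be an $s\times r$ matrix of polynomials in $d$ complex variables such that $B_\delta$ is connected and has more than one point. Then for every $f\in SA(B_\delta)$ and all $z,w\in B_\delta$, $$d_{\mathbb{D}}(f(z),f(w))\le d_\delta(z,w)\le d_{B_\delta}(z,w).$$
   Context: $B_\delta:=\{z\in\mathbb{C}^d : \|\delta(z)\|<1\}$, with the operator norm on $B(\mathbb{C}^r,\mathbb{C}^s)$. For $z,w\in B_\delta$, $$d_\delta(z,w):=\left\|(I-\delta(w)\delta(w)^* )^{-1/2}(\delta(z)-\delta(w))(I-\delta(w)^*\delta(z))^{-1}(I-\delta(w)^*\delta(w))^{1/2}\right\|.$$ With $\mathbb{D}$ the open unit disk, $d_{\mathbb{D}}(\alpha,\beta)=\left|\frac{\alpha-\beta}{1-\overline{\beta}\alpha}\right|$ for $\alpha,\beta\in\mathbb{D}$, and $d_{\mathbb{D}}(\alpha,\alpha)=0$ if $|\alpha|=1$. For a domain $\Omega\subset\mathbb{C}^d$ the Möbius pseudo-distance is $d_\Omega(z,w)=\sup\{d_{\mathbb{D}}(f(z),f(w)) : f:\Omega\to\mathbb{D}\text{ holomorphic}\}$. The Schur–Agler class $SA(B_\delta)$: fix a separable infinite-dimensional Hilbert space $H$. $SA(B_\delta)$ is the set of holomorphic $f:B_\delta\to\mathbb{C}$ such that $\|f(T)\|\le 1$ for every commuting $d$-tuple $T$ of bounded operators on $H$ with $\|\delta(T)\|<1$. (For such $T$ the Taylor spectrum lies in $B_\delta$, and $f(T)$ is defined by the Taylor functional calculus; $\delta(T)$ is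 the operator matrix obtained by evaluating the entries of $\delta$ at $T$.) Every $f\in SA(B_\delta)$ is holomorphic with values in the closed unit disk, hence, $B_\delta$ being connected, either maps into $\mathbb{D}$ or is a unimodular constant. *)

theory Defs
  imports "HOL-Analysis.Analysis" "HOL-Library.Poly_Mapping" "HOL-Library.Countable"
begin

section \<open>Matrices of polynomials and the domain\<close>

type_synonym 'd cpoly = "('d \<Rightarrow>\<^sub>0 nat) \<Rightarrow>\<^sub>0 complex"

definition cpoly_eval :: "'d::finite cpoly \<Rightarrow> complex ^ 'd \<Rightarrow> complex" where
  "cpoly_eval p z =
     (\<Sum>m\<in>Poly_Mapping.keys p.
        Poly_Mapping.lookup p m * (\<Prod>i\<in>UNIV. (z $ i) ^ Poly_Mapping.lookup m i))"

definition cpmat_eval :: "('d::finite cpoly) ^ 'r ^ 's \<Rightarrow> complex ^ 'd \<Rightarrow> complex ^ 'r ^ 's" where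
  "cpmat_eval \<delta> z = (\<chi> i j. cpoly_eval (\<delta> $ i $ j) z)"

text \<open>
  The norm on \<^typ>\<open>complex ^ 'n\<close> is the Euclidean one, so this is the operator norm of
  the linear map from the Hilbert space of dimension r to that of dimension s.
\<close>

definition matrix_norm :: "complex ^ 'r ^ 's \<Rightarrow> real" where
  "matrix_norm A = onorm (\<lambda>x. A *v x)"

definition B_dom :: "('d::finite cpoly) ^ 'r ^ 's \<Rightarrow> (complex ^ 'd) set" where
  "B_dom \<delta> = {z. matrix_norm (cpmat_eval \<delta> z) < 1}"

definition mat_adjoint :: "complex ^ 'r ^ 's \<Rightarrow> complex ^ 's ^ 'r" where
  "mat_adjoint A = (\<chi> i j. cnj (A $ j $ i))"

definition mat_psd :: "complex ^ 'n ^ 'n \<Rightarrow> bool" where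
  "mat_psd A \<longleftrightarrow> mat_adjoint A = A \<and> (\<forall>x. 0 \<le> Re (\<Sum>i\<in>UNIV. cnj (x $ i) * (A *v x) $ i))"

definition mat_sqrt :: "complex ^ 'n ^ 'n \<Rightarrow> complex ^ 'n ^ 'n" where
  "mat_sqrt A = (THE B. mat_psd B \<and> B ** B = A)"

definition d_delta ::
  "('d::finite cpoly) ^ 'r ^ 's \<Rightarrow> complex ^ 'd \<Rightarrow> complex ^ 'd \<Rightarrow> real" where
  "d_delta \<delta> z w =
     (let Z = cpmat_eval \<delta> z; W = cpmat_eval \<delta> w in
      matrix_norm
        (matrix_inv (mat_sqrt (mat 1 - W ** mat_adjoint W))
         ** (Z - W)
         ** matrix_inv (mat 1 - mat_adjoint W ** Z)
         ** mat_sqrt (mat 1 - mat_adjoint W ** W)))"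


section \<open>Holomorphic functions and the Moebius pseudo-distance\<close>

text \<open>Complex Frechet differentiability at every point; used for open sets only.\<close>

definition holomorphic_fun :: "(complex ^ 'd::finite) set \<Rightarrow> (complex ^ 'd \<Rightarrow> complex) set" where
  "holomorphic_fun U =
     {f. \<forall>z\<in>U. \<exists>c. (f has_derivative (\<lambda>h. \<Sum>j\<in>UNIV. c $ j * h $ j)) (at z)}"

text \<open>
  For equal unimodular arguments the quotient is \<open>0 / 0 = 0\<close>, which is the required convention.
\<close>

definition d_disk :: "complex \<Rightarrow> complex \<Rightarrow> real" where
  "d_disk a b = cmod ((a - b) / (1 - cnj b * a))"

definition d_moebius :: "(complex ^ 'd::finite) set \<Rightarrow> complex ^ 'd \<Rightarrow> complex ^ 'd \<Rightarrow> real" where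
  "d_moebius \<Omega> z w = Sup {d_disk (f z) (f w) | f. f \<in> holomorphic_fun \<Omega> \<and> f ` \<Omega> \<subseteq> ball 0 1}"


section \<open>Complex Hilbert spaces and commuting tuples of operators\<close>

text \<open>The inner product is conjugate-linear in its first argument.\<close>

class complex_hilbert = banach +
  fixes scaleC :: "complex \<Rightarrow> 'a \<Rightarrow> 'a"  (infixr "*\<^sub>C" 75)
    and cinner :: "'a \<Rightarrow> 'a \<Rightarrow> complex"
  assumes scaleC_add_right: "a *\<^sub>C (x + y) = a *\<^sub>C x + a *\<^sub>C y"
    and scaleC_add_left: "(a + b) *\<^sub>C x = a *\<^sub>C x + b *\<^sub>C x"
    and scaleC_scaleC: "a *\<^sub>C (b *\<^sub>C x) = (a * b) *\<^sub>C x"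
    and scaleR_scaleC: "scaleR r x = complex_of_real r *\<^sub>C x"
    and cinner_commute: "cinner x y = cnj (cinner y x)"
    and cinner_add_left: "cinner (x + y) z = cinner x z + cinner y z"
    and cinner_scaleC_left: "cinner (a *\<^sub>C x) y = cnj a * cinner x y"
    and cinner_self: "cinner x x = complex_of_real ((norm x)\<^sup>2)"

definition separable_infinite_dim :: "'h::complex_hilbert itself \<Rightarrow> bool" where
  "separable_infinite_dim _ \<longleftrightarrow>
     (\<exists>D::'h set. countable D \<and> closure D = UNIV) \<and>
     \<not> (\<exists>B::'h set. finite B \<and> (\<forall>x. \<exists>c. x = (\<Sum>b\<in>B. c b *\<^sub>C b)))"

definition bounded_op :: "('h::complex_hilbert \<Rightarrow> 'h) \<Rightarrow> bool" where
  "bounded_op T \<longleftrightarrow> bounded_linear T \<and> (\<forall>a x. T (a *\<^sub>C x) = a *\<^sub>C T x)"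

definition commuting_tuple :: "('d \<Rightarrow> 'h::complex_hilbert \<Rightarrow> 'h) \<Rightarrow> bool" where
  "commuting_tuple T \<longleftrightarrow> (\<forall>i. bounded_op (T i)) \<and> (\<forall>i j. T i \<circ> T j = T j \<circ> T i)"

text \<open>The fold does not depend on the order of the factors because the operators commute.\<close>

definition op_monomial :: "('d::finite \<Rightarrow>\<^sub>0 nat) \<Rightarrow> ('d \<Rightarrow> 'h \<Rightarrow> 'h) \<Rightarrow> 'h \<Rightarrow> 'h" where
  "op_monomial m T = Finite_Set.fold (\<lambda>i A. (T i ^^ Poly_Mapping.lookup m i) \<circ> A) id UNIV"

definition op_poly :: "'d::finite cpoly \<Rightarrow> ('d \<Rightarrow> 'h::complex_hilbert \<Rightarrow> 'h) \<Rightarrow> 'h \<Rightarrow> 'h" where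
  "op_poly p T x =
     (\<Sum>m\<in>Poly_Mapping.keys p. Poly_Mapping.lookup p m *\<^sub>C op_monomial m T x)"

text \<open>
  The operator matrix, acting between the Hilbert space direct sums \<^typ>\<open>'h ^ 'r\<close> and
  \<^typ>\<open>'h ^ 's\<close>, whose norms are the square roots of the sums of the squared norms of
  the components.
\<close>

definition op_matrix ::
  "('d::finite cpoly) ^ 'r ^ 's \<Rightarrow> ('d \<Rightarrow> 'h::complex_hilbert \<Rightarrow> 'h) \<Rightarrow> 'h ^ 'r \<Rightarrow> 'h ^ 's" where
  "op_matrix \<delta> T x = (\<chi> i. \<Sum>j\<in>UNIV. op_poly (\<delta> $ i $ j) T (x $ j))"


section \<open>Taylor spectrum and Taylor functional calculus\<close>

text \<open>
  A cochain of degree p in the Koszul complex of a tuple of operators indexed by a finite set J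
  is an element of the tensor product of H with the p-th exterior power of the space with basis
  J; it is given by its coefficients, one for each p-element subset of J. The signs refer to the
  order of J induced by \<^const>\<open>to_nat\<close>; another order gives an isomorphic complex.
\<close>

definition koszul_cochains :: "'i set \<Rightarrow> nat \<Rightarrow> ('i set \<Rightarrow> 'h::complex_hilbert) set" where
  "koszul_cochains J p = {\<omega>. \<forall>S. \<omega> S \<noteq> 0 \<longrightarrow> S \<subseteq> J \<and> card S = p}"

definition koszul_d ::
  "'i::countable set \<Rightarrow> ('i \<Rightarrow> 'h \<Rightarrow> 'h) \<Rightarrow> ('i set \<Rightarrow> 'h::complex_hilbert) \<Rightarrow> 'i set \<Rightarrow> 'h" where
  "koszul_d J T \<omega> S =
     (if S \<subseteq> J
      then \<Sum>i\<in>S. (- 1) ^ card {j\<in>S. to_nat j < to_nat i} *\<^sub>R T i (\<omega> (S - {i}))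
      else 0)"

definition koszul_exact :: "'i::countable set \<Rightarrow> ('i \<Rightarrow> 'h::complex_hilbert \<Rightarrow> 'h) \<Rightarrow> bool" where
  "koszul_exact J T \<longleftrightarrow>
     (\<forall>p. \<forall>\<omega>\<in>koszul_cochains J p. koszul_d J T \<omega> = (\<lambda>_. 0) \<longrightarrow>
        (case p of
           0 \<Rightarrow> \<omega> = (\<lambda>_. 0)
         | Suc q \<Rightarrow> \<omega> \<in> koszul_d J T ` koszul_cochains J q))"

definition taylor_spectrum :: "('d::finite \<Rightarrow> 'h::complex_hilbert \<Rightarrow> 'h) \<Rightarrow> (complex ^ 'd) set" where
  "taylor_spectrum T = {z. \<not> koszul_exact UNIV (\<lambda>j x. (z $ j) *\<^sub>C x - T j x)}"

text \<open>
  The functional calculus is specified by Taylor's theorem together with the uniqueness theorem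
  of Zame and Putinar: it is the family, indexed by the open neighbourhoods U of the Taylor
  spectrum, of unital algebra homomorphisms from the holomorphic functions on U to the bounded
  operators that send the coordinate functions to the given operators, are continuous for
  locally uniform convergence, are compatible with restriction, and have the spectral mapping
  property for all finite tuples of holomorphic functions.
\<close>

definition is_taylor_calculus ::
  "('d::finite \<Rightarrow> 'h::complex_hilbert \<Rightarrow> 'h)
   \<Rightarrow> ((complex ^ 'd) set \<Rightarrow> (complex ^ 'd \<Rightarrow> complex) \<Rightarrow> 'h \<Rightarrow> 'h) \<Rightarrow> bool" where
  "is_taylor_calculus T \<Theta> \<longleftrightarrow>
     (\<forall>U. open U \<and> taylor_spectrum T \<subseteq> U \<longrightarrow>
        (\<forall>f\<in>holomorphic_fun U. bounded_op (\<Theta> U f)) \<and>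
        \<Theta> U (\<lambda>_. 1) = id \<and>
        (\<forall>i. \<Theta> U (\<lambda>z. z $ i) = T i) \<and>
        (\<forall>f\<in>holomorphic_fun U. \<forall>g\<in>holomorphic_fun U.
            \<Theta> U (\<lambda>z. f z + g z) = (\<lambda>x. \<Theta> U f x + \<Theta> U g x)) \<and>
        (\<forall>f\<in>holomorphic_fun U. \<forall>g\<in>holomorphic_fun U.
            \<Theta> U (\<lambda>z. f z * g z) = \<Theta> U f \<circ> \<Theta> U g) \<and>
        (\<forall>f\<in>holomorphic_fun U. \<forall>c. \<Theta> U (\<lambda>z. c * f z) = (\<lambda>x. c *\<^sub>C \<Theta> U f x)) \<and>
        (\<forall>F. \<forall>f\<in>holomorphic_fun U.
            (\<forall>n. F n \<in> holomorphic_fun U) \<and>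
            (\<forall>K. compact K \<and> K \<subseteq> U \<longrightarrow> uniform_limit K F f sequentially) \<longrightarrow>
            (\<lambda>n. onorm (\<lambda>x. \<Theta> U (F n) x - \<Theta> U f x)) \<longlonglongrightarrow> 0) \<and>
        (\<forall>V. open V \<and> taylor_spectrum T \<subseteq> V \<and> V \<subseteq> U \<longrightarrow>
            (\<forall>f\<in>holomorphic_fun U. \<forall>g\<in>holomorphic_fun V.
               (\<forall>z\<in>V. f z = g z) \<longrightarrow> \<Theta> U f = \<Theta> V g)) \<and>
        (\<forall>m. \<forall>F::nat \<Rightarrow> complex ^ 'd \<Rightarrow> complex. (\<forall>j<m. F j \<in> holomorphic_fun U) \<longrightarrow>
            (\<forall>\<mu>::nat \<Rightarrow> complex.
               \<not> koszul_exact {..<m} (\<lambda>j x. \<mu> j *\<^sub>C x - \<Theta> U (F j) x) \<longleftrightarrow>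
               (\<exists>z\<in>taylor_spectrum T. \<forall>j<m. \<mu> j = F j z))))"

definition taylor_fc ::
  "('d::finite \<Rightarrow> 'h::complex_hilbert \<Rightarrow> 'h) \<Rightarrow> (complex ^ 'd) set
   \<Rightarrow> (complex ^ 'd \<Rightarrow> complex) \<Rightarrow> 'h \<Rightarrow> 'h" where
  "taylor_fc T U f = (THE A. \<exists>\<Theta>. is_taylor_calculus T \<Theta> \<and> A = \<Theta> U f)"


section \<open>The Schur--Agler class\<close>

definition schur_agler ::
  "'h::complex_hilbert itself \<Rightarrow> ('d::finite cpoly) ^ 'r ^ 's \<Rightarrow> (complex ^ 'd \<Rightarrow> complex) set" where
  "schur_agler _ \<delta> =
     {f \<in> holomorphic_fun (B_dom \<delta>).
        \<forall>T::'d \<Rightarrow> 'h \<Rightarrow> 'h. commuting_tuple T \<and> onorm (op_matrix \<delta> T) < 1 \<longrightarrow>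
          onorm (taylor_fc T (B_dom \<delta>) f) \<le> 1}"

end

theory Submission
  imports Defs "HOL-Complex_Analysis.Cauchy_Integral_Formula"
begin

text \<open>
  Left inequality: choose orthonormal vectors \<open>v\<close>, \<open>e\<close> and an oblique projection \<open>P\<close> onto the span of
  \<open>v\<close> with \<open>P e = s v\<close>, and test the Schur-Agler condition on \<open>T = z I + (w - z) P\<close>. On the span of
  \<open>v\<close> and \<open>e\<close> the matrix \<open>\<delta>(T)\<close> is the block matrix with rows \<open>(W, s (W - Z))\<close> and \<open>(0, Z)\<close>, which is a
  strict contraction if \<open>s\<^sup>2 = (1 - \<rho>\<^sup>2) / \<rho>\<^sup>2\<close> and \<open>\<rho>\<close> exceeds \<open>d_delta \<delta> z w\<close>. The spectrum of \<open>T\<close> is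
  \<open>{z, w}\<close> and \<open>f(T) = f(z) I + (f(w) - f(z)) P\<close>, so the contractivity of \<open>f(T)\<close> is the scalar case of the
  same condition, that is, \<open>d_disk (f z) (f w) \<le> \<rho>\<close>.

  Right inequality: the matrix \<open>M(\<zeta>)\<close> whose norm is \<open>d_delta \<delta> \<zeta> w\<close> is holomorphic in \<open>\<zeta>\<close>, strictly
  contractive and vanishes at \<open>w\<close>; a matrix coefficient of \<open>M\<close> that attains the norm of \<open>M(z)\<close> maps
  the domain into the disk.
\<close>

section \<open>Complex matrices\<close>

text \<open>The constant \<open>s\<close> is geometric. In the plane of \<open>v\<close> and
  \<open>e\<close> the eigenvectors of \<open>T\<close> are \<open>v\<close> for \<open>w\<close>
  and \<open>s v - e\<close> for \<open>z\<close>; the sine of their angle is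
  \<open>1 / sqrt (1 + s ^ 2)\<close>, and the choice of \<open>s\<close> makes it \<rho>. The class
  tests only strict contractions, so \<rho> stays above \<open>d_delta\<close> and is lowered to it
  at the end. Pointwise strictness of the block matrix becomes a uniform constant by compactness in
  finite dimension, before anything is transferred to the Hilbert space. The main obstacle is the
  evaluation of \<open>f(T)\<close>: the calculus is given by its characteristic properties, so both
  its existence and its uniqueness have to be proved for this \<open>T\<close>, for every function
  holomorphic near the two points. In several variables a function that vanishes at a point cannot
  be divided by one coordinate function. Hadamard's lemma replaces the division; it requires
  holomorphic partial derivatives, and these come from Cauchy's integral formula.\<close>

lemma inner_mat_adjoint:
  fixes A :: "complex ^ 'r ^ 's"
  shows "(A *v x) \<bullet> y = x \<bullet> (mat_adjoint A *v y)"
proof -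
  have "(A *v x) \<bullet> y = (\<Sum>i\<in>UNIV. \<Sum>j\<in>UNIV. (A $ i $ j * x $ j) \<bullet> y $ i)"
    by (simp add: inner_vec_def matrix_vector_mult_def inner_sum_left)
  also have "\<dots> = (\<Sum>j\<in>UNIV. \<Sum>i\<in>UNIV. x $ j \<bullet> (cnj (A $ i $ j) * y $ i))"
    by (subst sum.swap) (auto simp: inner_complex_def algebra_simps intro!: sum.cong)
  also have "\<dots> = x \<bullet> (mat_adjoint A *v y)"
    by (simp add: inner_vec_def matrix_vector_mult_def inner_sum_right mat_adjoint_def)
  finally show ?thesis .
qed

text \<open>The operation \<open>inner\<close> is the real part of the Hermitian product, yet it
  determines the conjugate transpose of a complex matrix. Adjoints can therefore be handled with
  real inner products throughout.\<close>

lemma mat_adjoint_unique: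
  fixes A :: "complex ^ 'r ^ 's"
  assumes "\<And>x y. (A *v x) \<bullet> y = x \<bullet> (B *v y)"
  shows "mat_adjoint A = B"
  unfolding matrix_eq
  by (metis assms inner_mat_adjoint vector_eq_ldot)

lemma mat_adjoint_adjoint [simp]: "mat_adjoint (mat_adjoint A) = A"
  by (simp add: mat_adjoint_def vec_eq_iff)

lemma mat_adjoint_mult:
  fixes A :: "complex ^ 'r ^ 's" and B :: "complex ^ 't ^ 'r"
  shows "mat_adjoint (A ** B) = mat_adjoint B ** mat_adjoint A"
  by (rule mat_adjoint_unique) (simp add: inner_mat_adjoint flip: matrix_vector_mul_assoc)

lemma mat_psd_iff:
  fixes A :: "complex ^ 'n ^ 'n"
  shows "mat_psd A \<longleftrightarrow> mat_adjoint A = A \<and> (\<forall>x. 0 \<le> x \<bullet> (A *v x))"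
  by (simp add: mat_psd_def inner_vec_def inner_complex_def)

lemma matrix_norm_apply: "norm (A *v x) \<le> matrix_norm A * norm (x :: complex ^ 'n)"
  unfolding matrix_norm_def by (rule onorm) simp

lemma matrix_norm_le: "(\<And>x. norm (A *v x) \<le> b * norm (x :: complex ^ 'n)) \<Longrightarrow> matrix_norm A \<le> b"
  unfolding matrix_norm_def by (rule onorm_le)

lemma matrix_norm_nonneg [simp]: "0 \<le> matrix_norm (A :: complex ^ 'r ^ 's)"
  unfolding matrix_norm_def by (rule onorm_pos_le) simp

text \<open>Compactness of the unit sphere. The extremal vector serves twice: it turns pointwise
  strict contractivity into \<open>onorm f < 1\<close>, and it supplies the matrix coefficient in
  the right inequality.\<close>

lemma onorm_attained:
  fixes f :: "'a::euclidean_space \<Rightarrow> 'b::real_normed_vector"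
  assumes f: "bounded_linear f"
  obtains x where "norm x = 1" "norm (f x) = onorm f"
proof -
  have "continuous_on (sphere 0 1) (\<lambda>x. norm (f x))"
    using f by (intro continuous_on_norm linear_continuous_on)
  moreover obtain b :: 'a where "b \<in> Basis"
    using nonempty_Basis by blast
  then have "sphere (0 :: 'a) 1 \<noteq> {}"
    by (metis empty_iff mem_sphere_0 norm_Basis)
  ultimately obtain x where x: "x \<in> sphere 0 1" "\<And>y. y \<in> sphere 0 1 \<Longrightarrow> norm (f y) \<le> norm (f x)"
    using continuous_attains_sup[OF compact_sphere] by metis
  have "norm (f y) \<le> norm (f x) * norm y" for y
  proof (cases "y = 0")
    case False
    have "f (inverse (norm y) *\<^sub>R y) = inverse (norm y) *\<^sub>R f y"
      using f by (simp add: linear_simps)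
    moreover have "inverse (norm y) *\<^sub>R y \<in> sphere 0 1"
      using False by simp
    ultimately have "norm (inverse (norm y) *\<^sub>R f y) \<le> norm (f x)"
      using x(2) by metis
    then have "inverse (norm y) * norm (f y) \<le> norm (f x)"
      by simp
    with False show ?thesis by (simp add: field_simps)
  qed (use f in \<open>simp add: linear_simps\<close>)
  then have "onorm f \<le> norm (f x)"
    by (rule onorm_le)
  moreover have "norm (f x) \<le> onorm f"
    using onorm[OF f, of x] x(1) by simp
  ultimately have "norm (f x) = onorm f"
    by simp
  with x(1) show ?thesis by (intro that[of x]) auto
qed

lemma onorm_less_1I:
  fixes f :: "'a::euclidean_space \<Rightarrow> 'b::real_normed_vector"
  assumes "bounded_linear f" "\<And>x. x \<noteq> 0 \<Longrightarrow> norm (f x) < norm x"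
  shows "onorm f < 1"
  using onorm_attained[of f] assms by (metis norm_zero zero_neq_one)

lemma matrix_norm_less_1D:
  fixes A :: "complex ^ 'r ^ 's"
  assumes "matrix_norm A < 1" "x \<noteq> 0"
  shows "norm (A *v x) < norm x"
proof -
  have "matrix_norm A * norm x < 1 * norm x"
    using assms by (intro mult_strict_right_mono) auto
  with matrix_norm_apply[of A x] show ?thesis by simp
qed

lemma matrix_norm_mult_le:
  fixes A :: "complex ^ 'r ^ 's" and B :: "complex ^ 't ^ 'r"
  shows "matrix_norm (A ** B) \<le> matrix_norm A * matrix_norm B"
  by (rule matrix_norm_le, simp add: matrix_vector_mul_assoc[symmetric] mult.assoc)
     (meson matrix_norm_apply matrix_norm_nonneg mult_left_mono order_trans)

lemma matrix_norm_adjoint_le: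
  fixes A :: "complex ^ 'r ^ 's"
  shows "matrix_norm (mat_adjoint A) \<le> matrix_norm A"
proof (rule matrix_norm_le)
  fix y :: "complex ^ 's"
  let ?a = "mat_adjoint A *v y"
  have "(norm ?a)\<^sup>2 = (A *v ?a) \<bullet> y"
    by (simp add: inner_mat_adjoint power2_norm_eq_inner)
  also have "\<dots> \<le> norm (A *v ?a) * norm y"
    by (rule norm_cauchy_schwarz)
  also have "\<dots> \<le> matrix_norm A * norm ?a * norm y"
    by (intro mult_right_mono matrix_norm_apply) simp
  finally have "norm ?a * norm ?a \<le> norm ?a * (matrix_norm A * norm y)"
    by (simp add: power2_eq_square mult_ac)
  then show "norm ?a \<le> matrix_norm A * norm y"
    by (cases "norm ?a = 0") (auto simp: mult_le_cancel_left)
qed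

lemma matrix_norm_adjoint [simp]: "matrix_norm (mat_adjoint A) = matrix_norm (A :: complex ^ 'r ^ 's)"
  using matrix_norm_adjoint_le[of A] matrix_norm_adjoint_le[of "mat_adjoint A"] by simp

lemma invertible_one_minus:
  fixes A :: "complex ^ 'n ^ 'n"
  assumes "matrix_norm A < 1"
  shows "invertible (mat 1 - A)"
proof -
  have "x = 0" if "(mat 1 - A) *v x = 0" for x
    using that matrix_norm_less_1D[OF assms, of x]
    by (auto simp: matrix_vector_mult_diff_rdistrib)
  then show ?thesis
    using matrix_left_invertible_ker[of "mat 1 - A"] invertible_left_inverse by blast
qed

text \<open>
  \<open>I - Y\<close> is a square root of \<open>I - X\<close> if and only if \<open>Y\<close> is a fixed point of
  \<open>Y \<mapsto> (X + Y\<^sup>2) / 2\<close>, which is a contraction of the ball of radius \<open>\<parallel>X\<parallel>\<close>.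
\<close>

lemma exists_mat_sqrt:
  fixes X :: "complex ^ 'n ^ 'n"
  assumes adj: "mat_adjoint X = X" and less: "matrix_norm X < 1"
  obtains Y where "mat_adjoint Y = Y" "matrix_norm Y < 1" "(mat 1 - Y) ** (mat 1 - Y) = mat 1 - X"
proof -
  define c where "c = matrix_norm X"
  \<comment> \<open>Matrices carry the Euclidean norm of their entries, whereas the contraction
    estimate concerns the operator norm. The Banach fixed point theorem is therefore applied to
    bounded operators.\<close>
  define B where "B = Blinfun ((*v) X)"
  have B: "blinfun_apply B = (*v) X"
    unfolding B_def by (rule bounded_linear_Blinfun_apply) simp
  have normB: "norm B = c"
    unfolding c_def matrix_norm_def by (simp add: norm_blinfun.rep_eq B)
  define F where "F Y = (1/2) *\<^sub>R (B + (Y o\<^sub>L Y))" for Y :: "(complex ^ 'n) \<Rightarrow>\<^sub>L (complex ^ 'n)"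
  \<comment> \<open>Elements of this operator space are only real-linear. Complex linearity and
    symmetry are closed conditions preserved by \<open>F\<close>, so the fixed point inherits them
    and is given by a self-adjoint complex matrix.\<close>
  define s where "s = {Y :: (complex ^ 'n) \<Rightarrow>\<^sub>L (complex ^ 'n). norm Y \<le> c \<and>
     (\<forall>a x. blinfun_apply Y (a *s x) = a *s blinfun_apply Y x) \<and>
     (\<forall>x y. blinfun_apply Y x \<bullet> y = x \<bullet> blinfun_apply Y y)}"
  have [simp]: "0 \<le> c" "c < 1" using less by (auto simp: c_def)
  have "closed s"
    unfolding s_def
  proof (intro closed_Collect_conj closed_Collect_all closed_Collect_le closed_Collect_eq continuous_intros)
    fix a and x :: "complex ^ 'n"
    have "bounded_linear (\<lambda>x :: complex ^ 'n. a *s x)"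
      by (intro linear_conv_bounded_linear[THEN iffD1] linearI) (vector algebra_simps)+
    then show "continuous_on UNIV (\<lambda>Y :: (complex ^ 'n) \<Rightarrow>\<^sub>L (complex ^ 'n). a *s Y x)"
      by (rule bounded_linear.continuous_on) (intro continuous_intros)
  qed
  moreover have "s \<noteq> {}"
    by (auto simp: s_def intro!: exI[of _ "0 :: (complex ^ 'n) \<Rightarrow>\<^sub>L (complex ^ 'n)"])
  moreover have "F ` s \<subseteq> s"
  proof safe
    fix Y assume Y: "Y \<in> s"
    then have n: "norm Y \<le> c" by (simp add: s_def)
    have "norm (B + (Y o\<^sub>L Y)) \<le> c + norm Y * norm Y"
      using norm_triangle_ineq[of B "Y o\<^sub>L Y"] norm_blinfun_compose[of Y Y] normB by linarith
    also have "norm Y * norm Y \<le> 1 * c"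
      using n \<open>c < 1\<close> norm_ge_zero[of Y] by (intro mult_mono) linarith+
    finally have "norm (F Y) \<le> c" by (simp add: F_def)
    moreover have "(F Y) (a *s x) = a *s (F Y) x" for a x
      using Y by (simp add: F_def s_def B blinfun.add_left blinfun.scaleR_left vec.scale)
        (vector algebra_simps)
    moreover have "(F Y) x \<bullet> y = x \<bullet> (F Y) y" for x y
      using Y by (simp add: F_def s_def B blinfun.add_left blinfun.scaleR_left inner_add inner_mat_adjoint adj)
    ultimately show "F Y \<in> s" by (simp add: s_def)
  qed
  moreover have "dist (F Y) (F Y') \<le> c * dist Y Y'" if "Y \<in> s" "Y' \<in> s" for Y Y'
  proof -
    have n: "norm Y \<le> c" "norm Y' \<le> c" using that by (auto simp: s_def)
    have "F Y - F Y' = (1/2) *\<^sub>R ((Y o\<^sub>L (Y - Y')) + ((Y - Y') o\<^sub>L Y'))"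
      by (rule blinfun_eqI) (simp add: F_def blinfun.add_left blinfun.diff_left blinfun.diff_right blinfun.scaleR_left algebra_simps)
    then have "dist (F Y) (F Y') = (1/2) * norm ((Y o\<^sub>L (Y - Y')) + ((Y - Y') o\<^sub>L Y'))"
      by (simp add: dist_norm)
    also have "\<dots> \<le> (1/2) * (norm Y * norm (Y - Y') + norm (Y - Y') * norm Y')"
      by (intro mult_left_mono norm_triangle_le add_mono norm_blinfun_compose) simp
    also have "\<dots> \<le> (1/2) * (c * norm (Y - Y') + norm (Y - Y') * c)"
      using n by (intro mult_left_mono add_mono mult_right_mono) auto
    finally show ?thesis by (simp add: dist_norm)
  qed
  ultimately have "\<exists>!Y. Y \<in> s \<and> F Y = Y"
    by (intro Banach_fix[of s c F]) (auto simp: complete_eq_closed)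
  then obtain Y where Y: "Y \<in> s" "F Y = Y" by blast
  define M where "M = matrix (blinfun_apply Y)"
  have "Vector_Spaces.linear (*s) (*s) (blinfun_apply Y)"
    using Y(1) by unfold_locales (auto simp: s_def blinfun.add_right vector_add_ldistrib)
  then have M: "M *v x = Y x" for x
    unfolding M_def by (rule matrix_works)
  have eq: "M *v x + M *v x = X *v x + M *v (M *v x)" for x
  proof -
    have "2 *\<^sub>R F Y = B + (Y o\<^sub>L Y)" by (simp add: F_def)
    then have "2 *\<^sub>R Y x = (B + (Y o\<^sub>L Y)) x" by (metis Y(2) blinfun.scaleR_left)
    then show ?thesis by (simp add: M blinfun.add_left B scaleR_2)
  qed
  show ?thesis
  proof
    show "mat_adjoint M = M"
      using Y(1) by (intro mat_adjoint_unique) (simp add: M s_def)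
    have "matrix_norm M = norm Y"
      by (simp add: matrix_norm_def M norm_blinfun.rep_eq)
    then show "matrix_norm M < 1"
      using Y(1) less by (simp add: s_def c_def)
    show "(mat 1 - M) ** (mat 1 - M) = mat 1 - X"
      unfolding matrix_eq
      using eq by (simp add: matrix_vector_mul_assoc[symmetric] matrix_vector_mult_diff_rdistrib
          matrix_vector_mult_diff_distrib algebra_simps)
  qed
qed

text \<open>With \<open>D = B - C\<close> one has \<open>B D + D C = 0\<close>, so \<open>tr (D B D) + tr (D C D) = 0\<close>.\<close>

lemma mat_psd_sqrt_unique:
  fixes B C :: "complex ^ 'n ^ 'n"
  assumes B: "mat_psd B" and C: "mat_adjoint C = C" "\<And>x. x \<noteq> 0 \<Longrightarrow> 0 < x \<bullet> (C *v x)"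
    and eq: "B ** B = C ** C"
  shows "B = C"
proof -
  define D where "D = B - C"
  have adjB: "mat_adjoint B = B" and posB: "\<And>x. 0 \<le> x \<bullet> (B *v x)"
    using B by (auto simp: mat_psd_iff)
  have D: "D *v x = B *v x - C *v x" for x
    by (simp add: D_def matrix_vector_mult_diff_rdistrib)
  have adjD: "mat_adjoint D = D"
    by (rule mat_adjoint_unique) (simp add: D inner_diff inner_mat_adjoint adjB C(1))
  have BD: "B *v (D *v x) = - (D *v (C *v x))" for x
    using arg_cong[OF eq, of "\<lambda>M. M *v x"]
    by (simp add: D matrix_vector_mult_diff_distrib matrix_vector_mul_assoc[symmetric])
  \<comment> \<open>Cyclicity of the trace, written over the real orthonormal basis: expand each
    inner product and swap the two sums.\<close>
  have trace: "(\<Sum>b\<in>Basis. (D *v b) \<bullet> (C *v (D *v b))) = (\<Sum>b\<in>Basis. (D *v b) \<bullet> (D *v (C *v b)))"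
  proof -
    have "(\<Sum>b\<in>Basis. (D *v b) \<bullet> (C *v (D *v b)))
        = (\<Sum>b\<in>Basis. \<Sum>c\<in>Basis. ((C *v (D *v b)) \<bullet> c) * ((D *v b) \<bullet> c))"
      by (subst euclidean_inner) (simp add: mult.commute)
    also have "\<dots> = (\<Sum>c\<in>Basis. \<Sum>b\<in>Basis. ((D *v (C *v c)) \<bullet> b) * ((D *v c) \<bullet> b))"
    proof -
      have "(C *v (D *v b)) \<bullet> c = (D *v (C *v c)) \<bullet> b" "(D *v b) \<bullet> c = (D *v c) \<bullet> b" for b c
        using inner_mat_adjoint[of C "D *v b" c] inner_mat_adjoint[of D b "C *v c"] inner_mat_adjoint[of D b c]
        by (simp_all add: adjD C(1) inner_commute)
      then show ?thesis by (subst sum.swap) simp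
    qed
    also have "\<dots> = (\<Sum>c\<in>Basis. (D *v (C *v c)) \<bullet> (D *v c))"
      by (subst euclidean_inner[symmetric]) simp
    finally show ?thesis by (simp add: inner_commute)
  qed
  have "(\<Sum>b\<in>Basis. (D *v b) \<bullet> (C *v (D *v b)) + (D *v b) \<bullet> (B *v (D *v b))) = 0"
    by (simp add: sum_subtractf trace BD)
  moreover have nonneg: "0 \<le> (D *v b) \<bullet> (C *v (D *v b)) + (D *v b) \<bullet> (B *v (D *v b))" for b
    using C(2)[of "D *v b"] posB[of "D *v b"] by (cases "D *v b = 0") auto
  ultimately have "\<forall>b\<in>Basis. (D *v b) \<bullet> (C *v (D *v b)) + (D *v b) \<bullet> (B *v (D *v b)) = 0"
    by (subst (asm) sum_nonneg_eq_0_iff) auto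
  then have zero: "D *v b = 0" if "b \<in> Basis" for b
    using C(2)[of "D *v b"] posB[of "D *v b"] that by force
  have "(*v) D = (\<lambda>_. 0)"
    by (rule linear_eq_stdbasis) (auto simp: zero linear_zero)
  then show ?thesis
    by (metis D matrix_eq right_minus_eq)
qed

text \<open>For the fixed point \<open>Y\<close>, the bound \<open>matrix_norm Y < 1\<close> makes
  \<open>mat 1 - Y\<close> strictly positive. Uniqueness then applies, and the definite description
  in \<open>mat_sqrt\<close> denotes this matrix.\<close>

lemma mat_sqrt_one_minus:
  fixes X :: "complex ^ 'n ^ 'n"
  assumes "mat_adjoint X = X" and "matrix_norm X < 1"
  defines "S \<equiv> mat_sqrt (mat 1 - X)"
  shows "mat_adjoint S = S" "S ** S = mat 1 - X" "invertible S"
proof -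
  obtain Y where Y: "mat_adjoint Y = Y" "matrix_norm Y < 1" "(mat 1 - Y) ** (mat 1 - Y) = mat 1 - X"
    using exists_mat_sqrt[OF assms(1,2)] .
  let ?C = "mat 1 - Y"
  have adj: "mat_adjoint ?C = ?C"
    by (rule mat_adjoint_unique)
       (simp add: matrix_vector_mult_diff_rdistrib inner_diff inner_mat_adjoint Y(1))
  have pos: "0 < x \<bullet> (?C *v x)" if "x \<noteq> 0" for x
  proof -
    have "x \<bullet> (Y *v x) \<le> norm x * norm (Y *v x)" by (rule norm_cauchy_schwarz)
    also have "\<dots> < norm x * norm x"
      using matrix_norm_less_1D[OF Y(2) that] that by simp
    finally show ?thesis
      by (simp add: matrix_vector_mult_diff_rdistrib inner_diff flip: power2_norm_eq_inner power2_eq_square)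
  qed
  have psd: "mat_psd ?C"
    unfolding mat_psd_iff using adj pos by (metis inner_zero_left less_eq_real_def)
  have "S = ?C"
    unfolding S_def mat_sqrt_def
  proof (rule the_equality)
    fix B :: "complex ^ 'n ^ 'n" assume "mat_psd B \<and> B ** B = mat 1 - X"
    then show "B = ?C" using mat_psd_sqrt_unique[of B ?C] adj pos Y(3) by metis
  qed (use psd Y(3) in simp)
  then show "mat_adjoint S = S" "S ** S = mat 1 - X" "invertible S"
    using adj Y invertible_one_minus by auto
qed

section \<open>The matrix Moebius map\<close>

lemma matrix_inv_vec:
  fixes A :: "complex ^ 'n ^ 'n"
  assumes "invertible A"
  shows "matrix_inv A *v (A *v x) = x" "A *v (matrix_inv A *v x) = x"
proof -
  have "A ** matrix_inv A = mat 1 \<and> matrix_inv A ** A = mat 1"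
    using assms unfolding invertible_def matrix_inv_def by (rule someI_ex)
  then show "matrix_inv A *v (A *v x) = x" "A *v (matrix_inv A *v x) = x"
    by (simp_all add: matrix_vector_mul_assoc)
qed

text \<open>With \<open>S\<close> the root, \<open>v = S (S b)\<close> gives
  \<open>inverse S v = S b\<close>, whose squared norm is \<open>v\<close> against \<open>b\<close>.
  This removes the square roots from all later norm computations.\<close>

lemma norm_matrix_inv_sqrt:
  fixes X :: "complex ^ 'n ^ 'n"
  assumes X: "mat_adjoint X = X" "matrix_norm X < 1" and b: "(mat 1 - X) *v b = v"
  shows "(norm (matrix_inv (mat_sqrt (mat 1 - X)) *v v))\<^sup>2 = v \<bullet> b"
proof -
  let ?S = "mat_sqrt (mat 1 - X)"
  note S = mat_sqrt_one_minus[OF X]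
  have "?S *v (?S *v b) = v"
    using b S(2) by (simp add: matrix_vector_mul_assoc)
  then have "matrix_inv ?S *v v = ?S *v b"
    using matrix_inv_vec(1)[OF S(3)] by metis
  then show ?thesis
    using \<open>?S *v (?S *v b) = v\<close> S(1) by (simp add: power2_norm_eq_inner inner_mat_adjoint inner_commute)
qed

lemma mat_adjoint_gram [simp]:
  fixes W :: "complex ^ 'r ^ 's"
  shows "mat_adjoint (W ** mat_adjoint W) = W ** mat_adjoint W"
    "mat_adjoint (mat_adjoint W ** W) = mat_adjoint W ** W"
  by (simp_all add: mat_adjoint_mult)

lemma matrix_norm_mult_less_1:
  fixes A :: "complex ^ 'r ^ 's" and B :: "complex ^ 't ^ 'r"
  assumes "matrix_norm A < 1" "matrix_norm B < 1"
  shows "matrix_norm (A ** B) < 1"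
proof -
  have "matrix_norm A * matrix_norm B \<le> 1 * matrix_norm B"
    using assms by (intro mult_right_mono) auto
  with assms matrix_norm_mult_le[of A B] show ?thesis by simp
qed

text \<open>The formula inside \<open>d_delta\<close>, for arbitrary matrices: the Moebius
  transformation of the matrix unit ball that carries \<open>W\<close> to \<open>0\<close>.\<close>

definition moebius_mat :: "complex ^ 'r ^ 's \<Rightarrow> complex ^ 'r ^ 's \<Rightarrow> complex ^ 'r ^ 's" where
  "moebius_mat W Z =
     matrix_inv (mat_sqrt (mat 1 - W ** mat_adjoint W)) ** (Z - W)
     ** matrix_inv (mat 1 - mat_adjoint W ** Z) ** mat_sqrt (mat 1 - mat_adjoint W ** W)"

lemma d_delta_moebius_mat:
  "d_delta \<delta> z w = matrix_norm (moebius_mat (cpmat_eval \<delta> w) (cpmat_eval \<delta> z))"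
  by (simp add: d_delta_def moebius_mat_def Let_def)

text \<open>The identity behind this is that the Moebius map preserves the indefinite form
  \<open>norm x ^ 2 - norm p ^ 2\<close> on graphs of contractions. Parametrising the argument by
  \<open>y\<close> cancels the factor \<open>matrix_inv (mat 1 - mat_adjoint W ** Z)\<close>, and by
  the last claim no argument is lost.\<close>

lemma moebius_mat_isometry:
  fixes Z W :: "complex ^ 'r ^ 's"
  assumes Z: "matrix_norm Z < 1" and W: "matrix_norm W < 1"
  defines "x y \<equiv> matrix_inv (mat_sqrt (mat 1 - mat_adjoint W ** W)) *v ((mat 1 - mat_adjoint W ** Z) *v y)"
  shows "moebius_mat W Z *v x y =
      matrix_inv (mat_sqrt (mat 1 - W ** mat_adjoint W)) *v ((Z - W) *v y)"
    and "(norm (x y))\<^sup>2 - (norm (moebius_mat W Z *v x y))\<^sup>2 = (norm y)\<^sup>2 - (norm (Z *v y))\<^sup>2"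
    and "\<exists>y. v = x y"
proof -
  let ?W' = "mat_adjoint W" and ?S = "mat_sqrt (mat 1 - mat_adjoint W ** W)"
  have less: "matrix_norm (?W' ** W) < 1" "matrix_norm (W ** ?W') < 1" "matrix_norm (?W' ** Z) < 1"
    using Z W by (auto intro!: matrix_norm_mult_less_1)
  note inv = matrix_inv_vec[OF mat_sqrt_one_minus(3)[OF mat_adjoint_gram(2) less(1)]]
    matrix_inv_vec[OF invertible_one_minus[OF less(3)]]
  show Mx: "moebius_mat W Z *v x y =
      matrix_inv (mat_sqrt (mat 1 - W ** ?W')) *v ((Z - W) *v y)" for y
    by (simp add: moebius_mat_def x_def matrix_vector_mul_assoc[symmetric] inv)
  show "\<exists>y. v = x y"
    by (rule exI[of _ "matrix_inv (mat 1 - ?W' ** Z) *v (?S *v v)"]) (simp add: x_def inv)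
  define p u t where "p = Z *v y" and "u = y - ?W' *v p" and "t = p - W *v y"
  have u: "(mat 1 - ?W' ** Z) *v y = u" and t: "(Z - W) *v y = t"
    by (simp_all add: u_def t_def p_def matrix_vector_mult_diff_rdistrib matrix_vector_mul_assoc)
  define b where "b = matrix_inv (mat 1 - W ** ?W') *v t"
  have b: "(mat 1 - W ** ?W') *v b = t"
    unfolding b_def by (rule matrix_inv_vec(2)) (rule invertible_one_minus[OF less(2)])
  then have b': "b - W *v (?W' *v b) = t"
    by (simp add: matrix_vector_mult_diff_rdistrib matrix_vector_mul_assoc)
  \<comment> \<open>This is \<open>u\<close> multiplied by the inverse of
    \<open>mat 1 - mat_adjoint W ** W\<close>, expressed through \<open>b\<close>. The relation
    \<open>W *v a = p - b\<close> makes the mixed terms of the two squared norms cancel.\<close>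
  define a where "a = y - ?W' *v b"
  have "?W' *v b - ?W' *v (W *v (?W' *v b)) = ?W' *v t"
    by (simp flip: b' add: matrix_vector_mult_diff_distrib)
  then have a: "(mat 1 - ?W' ** W) *v a = u"
    by (simp add: a_def u_def t_def matrix_vector_mult_diff_rdistrib
        matrix_vector_mult_diff_distrib flip: matrix_vector_mul_assoc)
  have "W *v a = W *v y - (b - t)"
    using b' by (simp add: a_def matrix_vector_mult_diff_distrib algebra_simps)
  then have Wa: "W *v a = p - b" by (simp add: t_def)
  have "(norm (x y))\<^sup>2 = u \<bullet> a"
    unfolding x_def u by (rule norm_matrix_inv_sqrt[OF _ less(1) a]) simp
  moreover have "(norm (moebius_mat W Z *v x y))\<^sup>2 = t \<bullet> b"
    unfolding Mx t by (rule norm_matrix_inv_sqrt[OF _ less(2) b]) simp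
  moreover have "u \<bullet> a = y \<bullet> a - p \<bullet> (p - b)"
    by (simp add: u_def inner_diff_left inner_mat_adjoint flip: Wa)
  moreover have "t \<bullet> b = p \<bullet> b - y \<bullet> (y - a)"
    by (simp add: t_def inner_diff_left inner_mat_adjoint a_def)
  ultimately show "(norm (x y))\<^sup>2 - (norm (moebius_mat W Z *v x y))\<^sup>2 = (norm y)\<^sup>2 - (norm (Z *v y))\<^sup>2"
    by (simp add: p_def power2_norm_eq_inner inner_diff_right)
qed

lemma matrix_norm_moebius_mat_less_1:
  fixes Z W :: "complex ^ 'r ^ 's"
  assumes Z: "matrix_norm Z < 1" and W: "matrix_norm W < 1"
  shows "matrix_norm (moebius_mat W Z) < 1"
  unfolding matrix_norm_def
proof (rule onorm_less_1I)
  fix v :: "complex ^ 'r" assume "v \<noteq> 0"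
  obtain y where y: "v = matrix_inv (mat_sqrt (mat 1 - mat_adjoint W ** W)) *v ((mat 1 - mat_adjoint W ** Z) *v y)"
    using moebius_mat_isometry(3)[OF Z W] by blast
  with \<open>v \<noteq> 0\<close> have "y \<noteq> 0" by auto
  then have "(norm (Z *v y))\<^sup>2 < (norm y)\<^sup>2"
    using matrix_norm_less_1D[OF Z] by (simp add: power_strict_mono)
  then have "(norm (moebius_mat W Z *v v))\<^sup>2 < (norm v)\<^sup>2"
    using moebius_mat_isometry(2)[OF Z W, of y] unfolding y by linarith
  then show "norm (moebius_mat W Z *v v) < norm v"
    by (rule power_less_imp_less_base) simp
qed simp

text \<open>The supremum over \<open>x\<close> is attained at \<open>x = W\<^sup>* b\<close>.\<close>

lemma contraction_complete_square:
  fixes W :: "complex ^ 'r ^ 's"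
  assumes W: "matrix_norm W < 1" and b: "(mat 1 - W ** mat_adjoint W) *v b = q"
  shows "(norm (W *v x + q))\<^sup>2 \<le> (norm x)\<^sup>2 + q \<bullet> b"
proof -
  let ?W' = "mat_adjoint W"
  define h where "h = x - ?W' *v b"
  have q: "q = b - W *v (?W' *v b)"
    using b by (simp add: matrix_vector_mult_diff_rdistrib matrix_vector_mul_assoc)
  have Wxq: "W *v x + q = b + W *v h"
    by (simp add: h_def q matrix_vector_mult_diff_distrib)
  have x: "x = ?W' *v b + h" by (simp add: h_def)
  have qb: "q \<bullet> b = b \<bullet> b - (?W' *v b) \<bullet> (?W' *v b)"
    by (simp add: q inner_diff_left inner_mat_adjoint)
  have cross: "b \<bullet> (W *v h) = (?W' *v b) \<bullet> h"
    by (metis inner_commute inner_mat_adjoint)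
  have "norm (W *v h) \<le> norm h"
    using matrix_norm_less_1D[OF W, of h] by (cases "h = 0") auto
  then have "(norm (W *v h))\<^sup>2 \<le> (norm h)\<^sup>2" by (simp add: power_mono)
  then have "(W *v h) \<bullet> (W *v h) \<le> h \<bullet> h" by (simp add: power2_norm_eq_inner)
  moreover have "(norm (b + W *v h))\<^sup>2 = b \<bullet> b + 2 * ((?W' *v b) \<bullet> h) + (W *v h) \<bullet> (W *v h)"
    by (simp add: power2_norm_eq_inner inner_add cross inner_commute[of "W *v h" b])
  moreover have "(norm (?W' *v b + h))\<^sup>2 = (?W' *v b) \<bullet> (?W' *v b) + 2 * ((?W' *v b) \<bullet> h) + h \<bullet> h"
    by (simp add: power2_norm_eq_inner inner_add inner_commute)
  ultimately show ?thesis
    unfolding Wxq by (simp add: x qb)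
qed

text \<open>Completing the square eliminates \<open>x\<close> and leaves
  \<open>s ^ 2 * N < D\<close>. The isometry turns the norm \<open>d\<close> of the Moebius matrix
  into \<open>N \<le> d ^ 2 * (N + D)\<close>, that is,
  \<open>(1 - d ^ 2) * N \<le> d ^ 2 * D\<close>. So the critical value of \<open>s ^ 2\<close> is
  \<open>(1 - d ^ 2) / d ^ 2\<close> when \<open>d > 0\<close>, and replacing \<open>d\<close> by
  the larger \<rho> gives strictness.\<close>

lemma moebius_mat_block_less:
  fixes Z W :: "complex ^ 'r ^ 's"
  assumes Z: "matrix_norm Z < 1" and W: "matrix_norm W < 1"
    and \<rho>: "matrix_norm (moebius_mat W Z) < \<rho>" "\<rho> < 1" and s: "s\<^sup>2 = (1 - \<rho>\<^sup>2) / \<rho>\<^sup>2"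
    and nz: "x \<noteq> 0 \<or> y \<noteq> 0"
  shows "(norm (W *v x + s *\<^sub>R ((W - Z) *v y)))\<^sup>2 + (norm (Z *v y))\<^sup>2 < (norm x)\<^sup>2 + (norm y)\<^sup>2"
proof (cases "y = 0")
  case True
  then show ?thesis
    using nz matrix_norm_less_1D[OF W, of x] by (simp add: power_strict_mono)
next
  case False
  let ?W' = "mat_adjoint W" and ?M = "moebius_mat W Z"
  define d where "d = matrix_norm ?M"
  define t where "t = (Z - W) *v y"
  define N where "N = (norm (matrix_inv (mat_sqrt (mat 1 - W ** ?W')) *v t))\<^sup>2"
  have d: "0 \<le> d" "d < \<rho>" "0 < \<rho>" "d < 1"
    using \<rho> by (simp_all add: d_def) (use matrix_norm_nonneg[of ?M] in linarith)+
  have dr: "d\<^sup>2 < \<rho>\<^sup>2" "\<rho>\<^sup>2 < 1" "d\<^sup>2 < 1"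
    using d \<rho>(2) by (simp_all add: power_strict_mono power_less_one_iff abs_square_less_1)
  define D where "D = (norm y)\<^sup>2 - (norm (Z *v y))\<^sup>2"
  have D: "D > 0"
    using matrix_norm_less_1D[OF Z False] by (simp add: D_def power_strict_mono)
  have "N \<le> d\<^sup>2 * (N + D)"
  proof -
    let ?v = "matrix_inv (mat_sqrt (mat 1 - ?W' ** W)) *v ((mat 1 - ?W' ** Z) *v y)"
    have N: "(norm (?M *v ?v))\<^sup>2 = N" "(norm ?v)\<^sup>2 = N + D"
      using moebius_mat_isometry(1,2)[OF Z W, of y] by (simp_all add: N_def t_def D_def)
    have "norm (?M *v ?v) \<le> d * norm ?v"
      unfolding d_def by (rule matrix_norm_apply)
    then have "(norm (?M *v ?v))\<^sup>2 \<le> (d * norm ?v)\<^sup>2" by (simp add: power_mono)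
    then show ?thesis by (simp only: power_mult_distrib N)
  qed
  have sN: "s\<^sup>2 * N < D"
  proof -
    have "N * (1 - d\<^sup>2) \<le> d\<^sup>2 * D" using \<open>N \<le> d\<^sup>2 * (N + D)\<close> by (simp add: algebra_simps)
    then have "(1 - \<rho>\<^sup>2) * (N * (1 - d\<^sup>2)) \<le> (1 - \<rho>\<^sup>2) * (d\<^sup>2 * D)"
      using dr by (intro mult_left_mono) auto
    also have "\<dots> < (1 - d\<^sup>2) * (\<rho>\<^sup>2 * D)"
      using dr D by (simp add: algebra_simps)
    finally have "(1 - d\<^sup>2) * ((1 - \<rho>\<^sup>2) * N) < (1 - d\<^sup>2) * (\<rho>\<^sup>2 * D)" by (simp add: mult_ac)
    then have "(1 - \<rho>\<^sup>2) * N < \<rho>\<^sup>2 * D"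
      using dr by (simp add: mult_less_cancel_left)
    then show ?thesis using d by (simp add: s field_simps)
  qed
  have less: "matrix_norm (W ** ?W') < 1"
    using W by (auto intro!: matrix_norm_mult_less_1)
  define b where "b = matrix_inv (mat 1 - W ** ?W') *v t"
  have b: "(mat 1 - W ** ?W') *v b = t"
    unfolding b_def by (rule matrix_inv_vec(2)) (rule invertible_one_minus[OF less])
  have N: "N = t \<bullet> b"
    unfolding N_def by (rule norm_matrix_inv_sqrt[OF _ less b]) simp
  have q: "s *\<^sub>R ((W - Z) *v y) = (-s) *\<^sub>R t"
    by (simp add: t_def matrix_vector_mult_diff_rdistrib algebra_simps)
  have "(mat 1 - W ** ?W') *v ((-s) *\<^sub>R b) = (-s) *\<^sub>R t"
    by (subst linear_scale[OF matrix_vector_mul_linear]) (simp add: b)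
  from contraction_complete_square[OF W this, of x]
  have "(norm (W *v x + (-s) *\<^sub>R t))\<^sup>2 \<le> (norm x)\<^sup>2 + s\<^sup>2 * N"
    by (simp add: N power2_eq_square)
  then show ?thesis
    using sN unfolding q D_def by linarith
qed

text \<open>The product type has the Euclidean norm, so the block matrix is a linear map of
  finite-dimensional Euclidean spaces and attains its norm. The resulting uniform
  \<open>k < 1\<close> survives the passage to infinite dimension, which pointwise strictness would
  not.\<close>

lemma moebius_mat_block_contraction:
  fixes Z W :: "complex ^ 'r ^ 's"
  assumes Z: "matrix_norm Z < 1" and W: "matrix_norm W < 1"
    and \<rho>: "matrix_norm (moebius_mat W Z) < \<rho>" "\<rho> < 1" and s: "s\<^sup>2 = (1 - \<rho>\<^sup>2) / \<rho>\<^sup>2"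
  obtains k where "0 \<le> k" "k < 1" "\<And>x y. (norm (W *v x + s *\<^sub>R ((W - Z) *v y)))\<^sup>2 + (norm (Z *v y))\<^sup>2
      \<le> k\<^sup>2 * ((norm x)\<^sup>2 + (norm y)\<^sup>2)"
proof -
  define L where "L = (\<lambda>(x, y). (W *v x + s *\<^sub>R ((W - Z) *v y), Z *v y))"
  have "bounded_linear L"
    unfolding L_def case_prod_beta
    by (intro bounded_linear_Pair bounded_linear_add bounded_linear_const_scaleR
        bounded_linear_compose[OF matrix_vector_mul_bounded_linear] bounded_linear_fst bounded_linear_snd)
  have sq: "(norm (L (x, y)))\<^sup>2 = (norm (W *v x + s *\<^sub>R ((W - Z) *v y)))\<^sup>2 + (norm (Z *v y))\<^sup>2"
    "(norm (x, y))\<^sup>2 = (norm x)\<^sup>2 + (norm y)\<^sup>2" for x y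
    by (simp_all add: L_def norm_Pair)
  have "onorm L < 1"
  proof (rule onorm_less_1I[OF \<open>bounded_linear L\<close>])
    fix p :: "(complex ^ 'r) \<times> (complex ^ 'r)" assume "p \<noteq> 0"
    then have "(norm (L p))\<^sup>2 < (norm p)\<^sup>2"
      by (cases p) (auto simp: sq zero_prod_def intro!: moebius_mat_block_less[OF assms])
    then show "norm (L p) < norm p" by (rule power_less_imp_less_base) simp
  qed
  moreover have "(norm (L p))\<^sup>2 \<le> (onorm L)\<^sup>2 * (norm p)\<^sup>2" for p
    using onorm[OF \<open>bounded_linear L\<close>, of p] by (simp add: power_mono flip: power_mult_distrib)
  ultimately show ?thesis
    using that[of "onorm L"] onorm_pos_le[OF \<open>bounded_linear L\<close>] unfolding sq[symmetric] by blast
qed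

section \<open>Holomorphic functions of several variables\<close>

lemma holomorphic_fun_subset: "f \<in> holomorphic_fun U \<Longrightarrow> V \<subseteq> U \<Longrightarrow> f \<in> holomorphic_fun V"
  by (auto simp: holomorphic_fun_def)

lemma holomorphic_fun_cong:
  assumes "open U" "f \<in> holomorphic_fun U" "\<And>z. z \<in> U \<Longrightarrow> f z = g z"
  shows "g \<in> holomorphic_fun U"
  using assms unfolding holomorphic_fun_def
  by (blast intro: has_derivative_transform_within_open)

lemma holomorphic_fun_const: "(\<lambda>_. c) \<in> holomorphic_fun U"
  by (auto simp: holomorphic_fun_def intro!: exI[of _ 0])

lemma holomorphic_fun_coord: "(\<lambda>z. z $ i) \<in> holomorphic_fun U"
proof -
  have "((\<lambda>z. z $ i) has_derivative (\<lambda>h. \<Sum>j\<in>UNIV. axis i 1 $ j * h $ j)) (at z)" for z :: "complex ^ 'a"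
  proof -
    have "(\<lambda>h :: complex ^ 'a. \<Sum>j\<in>UNIV. axis i 1 $ j * h $ j) = (\<lambda>h. h $ i)"
      by (simp add: axis_def if_distrib[of "\<lambda>x. x * _"] cong: if_cong)
    then show ?thesis
      by (simp add: bounded_linear_imp_has_derivative bounded_linear_vec_nth)
  qed
  then show ?thesis by (auto simp: holomorphic_fun_def)
qed

lemma holomorphic_fun_add:
  assumes "f \<in> holomorphic_fun U" "g \<in> holomorphic_fun U"
  shows "(\<lambda>z. f z + g z) \<in> holomorphic_fun U"
  unfolding holomorphic_fun_def
proof safe
  fix z assume "z \<in> U"
  then obtain c d where "(f has_derivative (\<lambda>h. \<Sum>j\<in>UNIV. c $ j * h $ j)) (at z)"
    "(g has_derivative (\<lambda>h. \<Sum>j\<in>UNIV. d $ j * h $ j)) (at z)"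
    using assms unfolding holomorphic_fun_def by blast
  from has_derivative_add[OF this]
  show "\<exists>c. ((\<lambda>z. f z + g z) has_derivative (\<lambda>h. \<Sum>j\<in>UNIV. c $ j * h $ j)) (at z)"
    by (intro exI[of _ "c + d"]) (simp add: sum.distrib algebra_simps)
qed

lemma holomorphic_fun_mult:
  assumes "f \<in> holomorphic_fun U" "g \<in> holomorphic_fun U"
  shows "(\<lambda>z. f z * g z) \<in> holomorphic_fun U"
  unfolding holomorphic_fun_def
proof safe
  fix z assume "z \<in> U"
  then obtain c d where "(f has_derivative (\<lambda>h. \<Sum>j\<in>UNIV. c $ j * h $ j)) (at z)"
    "(g has_derivative (\<lambda>h. \<Sum>j\<in>UNIV. d $ j * h $ j)) (at z)"
    using assms unfolding holomorphic_fun_def by blast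
  from has_derivative_mult[OF this]
  show "\<exists>c. ((\<lambda>z. f z * g z) has_derivative (\<lambda>h. \<Sum>j\<in>UNIV. c $ j * h $ j)) (at z)"
    by (intro exI[of _ "f z *s d + g z *s c"])
       (simp add: sum.distrib sum_distrib_left sum_distrib_right algebra_simps)
qed

lemma holomorphic_fun_compose:
  assumes "f \<in> holomorphic_fun U" "\<And>z. z \<in> U \<Longrightarrow> g field_differentiable (at (f z))"
  shows "(\<lambda>z. g (f z)) \<in> holomorphic_fun U"
  unfolding holomorphic_fun_def
proof safe
  fix z assume "z \<in> U"
  then obtain c where "(f has_derivative (\<lambda>h. \<Sum>j\<in>UNIV. c $ j * h $ j)) (at z)"
    using assms by (auto simp: holomorphic_fun_def)
  moreover obtain d where "(g has_field_derivative d) (at (f z))"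
    using assms(2)[OF \<open>z \<in> U\<close>] by (auto simp: field_differentiable_def)
  ultimately have "((\<lambda>z. g (f z)) has_derivative (\<lambda>h. d * (\<Sum>j\<in>UNIV. c $ j * h $ j))) (at z)"
    by (auto simp: has_field_derivative_def intro: has_derivative_compose)
  then show "\<exists>c. ((\<lambda>z. g (f z)) has_derivative (\<lambda>h. \<Sum>j\<in>UNIV. c $ j * h $ j)) (at z)"
    by (intro exI[of _ "d *s c"]) (simp add: sum_distrib_left algebra_simps)
qed

lemma holomorphic_fun_uminus: "f \<in> holomorphic_fun U \<Longrightarrow> (\<lambda>z. - f z) \<in> holomorphic_fun U"
  using holomorphic_fun_mult[OF holomorphic_fun_const[of "-1"]] by simp

lemma holomorphic_fun_diff:
  "f \<in> holomorphic_fun U \<Longrightarrow> g \<in> holomorphic_fun U \<Longrightarrow> (\<lambda>z. f z - g z) \<in> holomorphic_fun U"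
  using holomorphic_fun_add[OF _ holomorphic_fun_uminus] by simp

lemma holomorphic_fun_divide:
  assumes "f \<in> holomorphic_fun U" "g \<in> holomorphic_fun U" "\<And>z. z \<in> U \<Longrightarrow> g z \<noteq> 0"
  shows "(\<lambda>z. f z / g z) \<in> holomorphic_fun U"
proof -
  have "(\<lambda>z. inverse (g z)) \<in> holomorphic_fun U"
    using assms(3) by (intro holomorphic_fun_compose[OF assms(2)] field_differentiable_inverse) auto
  from holomorphic_fun_mult[OF assms(1) this] show ?thesis by (simp add: divide_inverse)
qed

lemma holomorphic_fun_sum:
  "(\<And>i. i \<in> I \<Longrightarrow> f i \<in> holomorphic_fun U) \<Longrightarrow> (\<lambda>z. \<Sum>i\<in>I. f i z) \<in> holomorphic_fun U"
  by (induction I rule: infinite_finite_induct)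
     (auto intro: holomorphic_fun_add holomorphic_fun_const)

lemma holomorphic_fun_prod:
  "(\<And>i. i \<in> I \<Longrightarrow> f i \<in> holomorphic_fun U) \<Longrightarrow> (\<lambda>z. \<Prod>i\<in>I. f i z) \<in> holomorphic_fun U"
  by (induction I rule: infinite_finite_induct)
     (auto intro: holomorphic_fun_mult holomorphic_fun_const)

lemma holomorphic_fun_power: "f \<in> holomorphic_fun U \<Longrightarrow> (\<lambda>z. f z ^ n) \<in> holomorphic_fun U"
  by (induction n) (auto intro: holomorphic_fun_mult holomorphic_fun_const)

lemmas holomorphic_fun_intros =
  holomorphic_fun_const holomorphic_fun_coord holomorphic_fun_add holomorphic_fun_mult
  holomorphic_fun_diff holomorphic_fun_uminus holomorphic_fun_sum holomorphic_fun_prod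
  holomorphic_fun_power

lemma holomorphic_fun_continuous_on:
  "f \<in> holomorphic_fun U \<Longrightarrow> continuous_on U f"
  unfolding holomorphic_fun_def
  by (rule continuous_at_imp_continuous_on) (blast dest: has_derivative_continuous)

section \<open>Partial derivatives by Cauchy's formula, and Hadamard's lemma\<close>

lemma bounded_linear_axis: "bounded_linear (axis i :: complex \<Rightarrow> complex ^ 'n)"
  by (rule linear_conv_bounded_linear[THEN iffD1], rule linearI) (vector axis_def)+

lemma norm_axis_complex [simp]: "norm (axis i x :: complex ^ 'n) = norm x"
  by (simp add: norm_vec_def axis_def L2_set_def if_distrib[of norm] if_distrib[of "\<lambda>x. x\<^sup>2"] cong: if_cong)

text \<open>Defined by the one-variable \<open>deriv\<close> along a coordinate line, so that
  Cauchy's formula in the plane applies directly.\<close>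

definition cpartial :: "(complex ^ 'd \<Rightarrow> complex) \<Rightarrow> 'd \<Rightarrow> complex ^ 'd \<Rightarrow> complex" where
  "cpartial f i z = deriv (\<lambda>t. f (z + axis i t)) 0"

lemma has_field_derivative_axis:
  fixes f :: "complex ^ 'd \<Rightarrow> complex"
  assumes "(f has_derivative (\<lambda>h. \<Sum>j\<in>UNIV. c $ j * h $ j)) (at (z + axis i t))"
  shows "((\<lambda>t. f (z + axis i t)) has_field_derivative c $ i) (at t)"
proof -
  have "((\<lambda>t. z + axis i t) has_derivative axis i) (at t)"
    using bounded_linear_imp_has_derivative[OF bounded_linear_axis] by (auto intro!: derivative_eq_intros)
  from has_derivative_compose[OF this assms]
  have "((\<lambda>t. f (z + axis i t)) has_derivative (\<lambda>x. \<Sum>j\<in>UNIV. c $ j * axis i x $ j)) (at t)" .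
  also have "(\<lambda>x. \<Sum>j\<in>UNIV. c $ j * axis i x $ j) = (*) (c $ i)"
    by (simp add: fun_eq_iff axis_def if_distrib[of "\<lambda>x. _ * x"] cong: if_cong)
  finally show ?thesis by (simp add: has_field_derivative_def)
qed

lemma cpartial_eq:
  fixes f :: "complex ^ 'd \<Rightarrow> complex"
  assumes "(f has_derivative (\<lambda>h. \<Sum>j\<in>UNIV. c $ j * h $ j)) (at z)"
  shows "cpartial f i z = c $ i"
  unfolding cpartial_def
  by (rule DERIV_imp_deriv, rule has_field_derivative_axis) (use assms in \<open>simp add: axis_def flip: zero_vec_def\<close>)

lemma has_derivative_cpartial:
  fixes f :: "complex ^ 'd \<Rightarrow> complex"
  assumes "f \<in> holomorphic_fun U" "z \<in> U"
  shows "(f has_derivative (\<lambda>h. \<Sum>j\<in>UNIV. cpartial f j z * h $ j)) (at z)"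
proof -
  obtain c where c: "(f has_derivative (\<lambda>h. \<Sum>j\<in>UNIV. c $ j * h $ j)) (at z)"
    using assms by (auto simp: holomorphic_fun_def)
  then show ?thesis by (simp add: cpartial_eq[OF c])
qed

text \<open>On the circle \<open>u = r * exp (2 pi i t)\<close> the form
  \<open>du / (2 pi i u ^ 2)\<close> becomes \<open>exp (- 2 pi i t) / r dt\<close>. The interval of
  integration is independent of \<open>z\<close>, which makes differentiation under the integral
  sign possible.\<close>

lemma cpartial_Cauchy_integral:
  fixes f :: "complex ^ 'd \<Rightarrow> complex"
  assumes f: "f \<in> holomorphic_fun U" and r: "0 < r" "cball z r \<subseteq> U"
  shows "cpartial f i z = integral {0..1} (\<lambda>t. f (z + axis i (r * exp (2 * of_real pi * \<i> * of_real t)))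
           * (exp (- (2 * of_real pi * \<i> * of_real t)) / r))"
proof -
  let ?g = "\<lambda>t. f (z + axis i t)"
  have der: "\<exists>c. (?g has_field_derivative c) (at t)" if "t \<in> cball 0 r" for t
  proof -
    have "z + axis i t \<in> U" using that r by (auto simp: dist_norm)
    then show ?thesis using f has_field_derivative_axis unfolding holomorphic_fun_def by blast
  qed
  then have "continuous_on (cball 0 r) ?g"
    by (intro continuous_at_imp_continuous_on ballI) (blast dest: DERIV_isCont)
  moreover have "?g holomorphic_on ball 0 r"
    unfolding holomorphic_on_def field_differentiable_def
    using der by (meson ball_subset_cball has_field_derivative_at_within subsetD)
  ultimately have "(?g has_field_derivative (1 / (2 * of_real pi * \<i>) *
      contour_integral (circlepath 0 r) (\<lambda>u. ?g u / (u - 0)\<^sup>2))) (at 0)"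
    by (rule Cauchy_derivative_integral_circlepath(2)) (use r in simp)
  then have "cpartial f i z = 1 / (2 * of_real pi * \<i>) *
      contour_integral (circlepath 0 r) (\<lambda>u. ?g u / (u - 0)\<^sup>2)"
    unfolding cpartial_def by (rule DERIV_imp_deriv)
  also have "\<dots> = integral {0..1} (\<lambda>t. 1 / (2 * of_real pi * \<i>) *
      (?g (circlepath 0 r t) / (circlepath 0 r t - 0)\<^sup>2 * vector_derivative (circlepath 0 r) (at t)))"
    by (simp only: contour_integral_integral integral_mult_right)
  also have "\<dots> = integral {0..1} (\<lambda>t. f (z + axis i (r * exp (2 * of_real pi * \<i> * of_real t)))
           * (exp (- (2 * of_real pi * \<i> * of_real t)) / r))"
  proof (rule integral_cong)
    fix t :: real
    define e where "e = exp (2 * of_real pi * \<i> * of_real t)"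
    have e: "exp (- (2 * of_real pi * \<i> * of_real t)) = 1 / e" "e \<noteq> 0"
      by (simp_all add: e_def exp_minus inverse_eq_divide)
    have "circlepath 0 r t = r * e" "vector_derivative (circlepath 0 r) (at t) = 2 * pi * \<i> * r * e"
      by (simp add: circlepath e_def) (simp add: vector_derivative_circlepath e_def)
    then show "1 / (2 * of_real pi * \<i>) *
      (?g (circlepath 0 r t) / (circlepath 0 r t - 0)\<^sup>2 * vector_derivative (circlepath 0 r) (at t))
      = f (z + axis i (r * exp (2 * of_real pi * \<i> * of_real t))) * (exp (- (2 * of_real pi * \<i> * of_real t)) / r)"
      unfolding e(1) e_def[symmetric] using e(2) r(1) by (simp add: field_simps power2_eq_square)
  qed
  finally show ?thesis .
qed

lemma holomorphic_fun_integral: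
  fixes G :: "complex ^ 'd \<Rightarrow> real \<Rightarrow> complex"
  assumes U: "open U" "convex U"
    and der: "\<And>z t. z \<in> U \<Longrightarrow> t \<in> {0..1} \<Longrightarrow>
      ((\<lambda>z. G z t) has_derivative (\<lambda>h. \<Sum>j\<in>UNIV. c j z t * h $ j)) (at z)"
    and contc: "\<And>j. continuous_on (U \<times> {0..1}) (\<lambda>(z, t). c j z t)"
    and contG: "\<And>z. z \<in> U \<Longrightarrow> continuous_on {0..1} (G z)"
  shows "(\<lambda>z. integral {0..1} (G z)) \<in> holomorphic_fun U"
  unfolding holomorphic_fun_def
proof safe
  fix z0 assume z0: "z0 \<in> U"
  \<comment> \<open>The Leibniz rule expects the derivative as a continuous operator-valued
    function; its continuity reduces to that of the coefficients \<open>c j\<close>.\<close>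
  define D where "D z t = Blinfun (\<lambda>h. \<Sum>j\<in>UNIV. c j z t * h $ j)" for z t
  have D: "blinfun_apply (D z t) = (\<lambda>h. \<Sum>j\<in>UNIV. c j z t * h $ j)" for z t
    unfolding D_def
    by (intro bounded_linear_Blinfun_apply bounded_linear_sum bounded_linear_const_mult
        bounded_linear_vec_nth)
  have contD: "continuous_on (U \<times> cbox 0 1) (\<lambda>(z, t). D z t)"
  proof (rule continuous_on_blinfun_componentwise)
    fix b :: "complex ^ 'd"
    show "continuous_on (U \<times> cbox 0 1) (\<lambda>x. blinfun_apply (case x of (z, t) \<Rightarrow> D z t) b)"
      using contc by (auto simp: case_prod_beta D intro!: continuous_intros)
  qed
  have int: "(\<lambda>t. D z0 t) integrable_on cbox 0 1"
    by (intro integrable_continuous continuous_on_compose2[OF contD, of _ "\<lambda>t. (z0, t)", simplified])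
       (use z0 in \<open>auto intro!: continuous_intros\<close>)
  have intc: "(\<lambda>t. c j z0 t) integrable_on {0..1}" for j
  proof (rule integrable_continuous_real)
    have "continuous_on {0..1} (\<lambda>t. case (z0, t) of (z, t) \<Rightarrow> c j z t)"
      by (rule continuous_on_compose2[OF contc[of j]]) (use z0 in \<open>auto intro!: continuous_intros\<close>)
    then show "continuous_on {0..1} (c j z0)" by simp
  qed
  have "((\<lambda>z. integral (cbox 0 1) (G z)) has_derivative integral (cbox 0 1) (D z0)) (at z0 within U)"
  proof (rule leibniz_rule[OF _ _ contD z0 U(2)])
    fix z and t :: real assume "z \<in> U" "t \<in> cbox 0 1"
    then show "((\<lambda>z. G z t) has_derivative D z t) (at z within U)"
      using der by (auto simp: D intro: has_derivative_at_withinI)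
  qed (use contG in \<open>auto intro: integrable_continuous_real\<close>)
  moreover have "blinfun_apply (integral (cbox 0 1) (D z0)) = (\<lambda>h. \<Sum>j\<in>UNIV. integral {0..1} (c j z0) * h $ j)"
    by (rule ext, subst blinfun_apply_integral[OF int])
       (simp add: D integral_sum intc integrable_on_mult_left)
  ultimately show "\<exists>c. ((\<lambda>z. integral {0..1} (G z)) has_derivative (\<lambda>h. \<Sum>j\<in>UNIV. c $ j * h $ j)) (at z0)"
    using at_within_open[OF z0 U(1)] by (intro exI[of _ "\<chi> j. integral {0..1} (c j z0)"]) auto
qed

lemma continuous_on_axis_compose:
  fixes g :: "'a::topological_space \<Rightarrow> complex"
  shows "continuous_on S g \<Longrightarrow> continuous_on S (\<lambda>x. axis i (g x) :: complex ^ 'd)"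
  by (rule bounded_linear.continuous_on[OF bounded_linear_axis])

text \<open>The doubled radius leaves room for a circle of radius \<open>r\<close> around every
  point of \<open>ball a r\<close>.\<close>

lemma continuous_on_circle_shift:
  fixes f :: "complex ^ 'd \<Rightarrow> complex"
  assumes f: "continuous_on U f" and r: "0 < r" "cball a (2 * r) \<subseteq> U"
  shows "continuous_on (ball a r \<times> {0..1})
    (\<lambda>(z, t). f (z + axis i (r * exp (2 * of_real pi * \<i> * of_real t)))
      * (exp (- (2 * of_real pi * \<i> * of_real t)) / r))"
proof -
  have "continuous_on (ball a r \<times> {0..1})
      (\<lambda>x. f (fst x + axis i (r * exp (2 * of_real pi * \<i> * of_real (snd x)))))"
  proof (rule continuous_on_compose2[OF f])
    show "(\<lambda>x. fst x + axis i (r * exp (2 * of_real pi * \<i> * of_real (snd x)))) ` (ball a r \<times> {0..1}) \<subseteq> U"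
    proof safe
      fix z :: "complex ^ 'd" and t :: real assume z: "z \<in> ball a r"
      let ?s = "axis i (r * exp (2 * of_real pi * \<i> * of_real t)) :: complex ^ 'd"
      have "norm ?s = r" using r by (simp add: norm_mult)
      then have "dist a (z + ?s) \<le> 2 * r"
        using z norm_triangle_ineq4[of "a - z" ?s] by (simp add: dist_norm algebra_simps)
      then show "fst (z, t) + axis i (r * exp (2 * of_real pi * \<i> * of_real (snd (z, t)))) \<in> U"
        using r by auto
    qed
  qed (intro continuous_intros continuous_on_axis_compose)
  then show ?thesis
    unfolding case_prod_beta using r by (intro continuous_intros) auto
qed

text \<open>Pointwise complex differentiability is bootstrapped. Cauchy's formula involves only
  values of \<open>f\<close>, so continuity of \<open>f\<close> makes the partial derivatives
  continuous. That continuity is what allows the same formula to be differentiated under the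
  integral sign.\<close>

lemma
  fixes f :: "complex ^ 'd \<Rightarrow> complex"
  assumes U: "open U" and f: "f \<in> holomorphic_fun U"
  shows continuous_on_cpartial: "continuous_on U (cpartial f i)"
    and holomorphic_fun_cpartial: "cpartial f i \<in> holomorphic_fun U"
proof -
  let ?I = "\<lambda>i r z. integral {0..1} (\<lambda>t. f (z + axis i (r * exp (2 * of_real pi * \<i> * of_real t)))
      * (exp (- (2 * of_real pi * \<i> * of_real t)) / of_real r))"
  have r: "\<exists>r>0. cball a (2 * r) \<subseteq> U" if "a \<in> U" for a
  proof -
    obtain r where "r > 0" "cball a r \<subseteq> U"
      using U \<open>a \<in> U\<close> open_contains_cball by blast
    then show ?thesis by (intro exI[of _ "r / 2"]) auto
  qed
  have eq: "cpartial f i z = ?I i r z" if "0 < r" "cball a (2 * r) \<subseteq> U" "z \<in> ball a r" for i r a z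
  proof (rule cpartial_Cauchy_integral[OF f that(1)])
    have "cball z r \<subseteq> cball a (2 * r)"
      using that(3) by (simp add: cball_subset_cball_iff dist_commute)
    with that(2) show "cball z r \<subseteq> U" by blast
  qed
  show cont: "continuous_on U (cpartial f i)" for i
  proof (rule continuous_at_imp_continuous_on, safe)
    fix a assume "a \<in> U"
    then obtain r where r: "0 < r" "cball a (2 * r) \<subseteq> U" using r by blast
    have "continuous_on (ball a r) (?I i r)"
      using continuous_on_circle_shift[OF holomorphic_fun_continuous_on[OF f] r]
      unfolding cbox_interval[symmetric] by (rule integral_continuous_on_param)
    then have "continuous_on (ball a r) (cpartial f i)"
      using eq[OF r] by (subst continuous_on_cong[OF refl]) auto
    then show "isCont (cpartial f i) a"
      using r(1) by (simp add: continuous_on_eq_continuous_at)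
  qed
  show "cpartial f i \<in> holomorphic_fun U"
    unfolding holomorphic_fun_def
  proof safe
    fix a assume "a \<in> U"
    then obtain r where r: "0 < r" "cball a (2 * r) \<subseteq> U" using r by blast
    let ?c = "\<lambda>j z t. cpartial f j (z + axis i (r * exp (2 * of_real pi * \<i> * of_real t)))
      * (exp (- (2 * of_real pi * \<i> * of_real t)) / of_real r)"
    have "?I i r \<in> holomorphic_fun (ball a r)"
    proof (rule holomorphic_fun_integral[where c = ?c])
      fix z and t :: real assume z: "z \<in> ball a r" and t: "t \<in> {0..1}"
      let ?s = "axis i (r * exp (2 * of_real pi * \<i> * of_real t)) :: complex ^ 'd"
      have "norm ?s = r" using r by (simp add: norm_mult)
      then have "dist a (z + ?s) \<le> 2 * r"
        using z norm_triangle_ineq4[of "a - z" ?s] by (simp add: dist_norm algebra_simps)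
      then have "z + ?s \<in> U" using r by auto
      from has_derivative_cpartial[OF f this]
      have "((\<lambda>z. f (z + ?s)) has_derivative (\<lambda>h. \<Sum>j\<in>UNIV. cpartial f j (z + ?s) * h $ j)) (at z)"
        by (rule has_derivative_compose[rotated]) (auto intro!: derivative_eq_intros)
      from has_derivative_mult_left[OF this, of "exp (- (2 * of_real pi * \<i> * of_real t)) / of_real r"]
      show "((\<lambda>z. f (z + ?s) * (exp (- (2 * of_real pi * \<i> * of_real t)) / of_real r)) has_derivative
         (\<lambda>h. \<Sum>j\<in>UNIV. ?c j z t * h $ j)) (at z)"
        by (simp add: sum_distrib_left sum_divide_distrib mult_ac)
    next
      fix j
      show "continuous_on (ball a r \<times> {0..1}) (\<lambda>(z, t). ?c j z t)"
        by (rule continuous_on_circle_shift[OF cont r])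
    next
      fix z assume z: "z \<in> ball a r"
      have "continuous_on {0..1} (\<lambda>t. case (z, t) of (z, t) \<Rightarrow>
          f (z + axis i (r * exp (2 * of_real pi * \<i> * of_real t)))
          * (exp (- (2 * of_real pi * \<i> * of_real t)) / of_real r))"
        by (rule continuous_on_compose2[OF continuous_on_circle_shift[OF holomorphic_fun_continuous_on[OF f] r]])
           (use z in \<open>auto intro!: continuous_intros\<close>)
      then show "continuous_on {0..1} (\<lambda>t. f (z + axis i (r * exp (2 * of_real pi * \<i> * of_real t)))
          * (exp (- (2 * of_real pi * \<i> * of_real t)) / of_real r))"
        by (simp only: prod.case)
    qed auto
    then have "cpartial f i \<in> holomorphic_fun (ball a r)"
      by (rule holomorphic_fun_cong[rotated]) (use eq[OF r] in auto)
    then show "\<exists>c. (cpartial f i has_derivative (\<lambda>h. \<Sum>j\<in>UNIV. c $ j * h $ j)) (at a)"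
      using r(1) by (auto simp: holomorphic_fun_def)
  qed
qed

text \<open>Integrate the derivative of \<open>f\<close> along the segment from \<open>a\<close> to
  \<open>z\<close>: the coefficient \<open>g i\<close> is the mean of the \<open>i\<close>-th
  partial derivative over that segment.\<close>

lemma holomorphic_fun_Hadamard:
  fixes f :: "complex ^ 'd \<Rightarrow> complex"
  assumes U: "open U" "convex U" "a \<in> U" and f: "f \<in> holomorphic_fun U"
  obtains g where "\<And>i. g i \<in> holomorphic_fun U"
    "\<And>z. z \<in> U \<Longrightarrow> f z = f a + (\<Sum>i\<in>UNIV. (z $ i - a $ i) * g i z)"
proof
  define p where "p z t = a + t *\<^sub>R (z - a)" for z and t :: real
  have pU: "p z t \<in> U" if "z \<in> U" "t \<in> {0..1}" for z t
    using that convexD_alt[OF U(2,3), of z t] by (simp add: p_def algebra_simps)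
  have contp: "continuous_on (U \<times> {0..1}) (\<lambda>x. F (p (fst x) (snd x)))" if "continuous_on U F" for F :: "_ \<Rightarrow> complex"
  proof (rule continuous_on_compose2[OF that])
    show "continuous_on (U \<times> {0..1}) (\<lambda>x. p (fst x) (snd x))"
      unfolding p_def by (intro continuous_intros)
  qed (auto intro: pU)
  have contp': "continuous_on {0..1} (\<lambda>t. F (p z t))" if "continuous_on U F" "z \<in> U" for F :: "_ \<Rightarrow> complex" and z
  proof (rule continuous_on_compose2[OF that(1)])
    show "continuous_on {0..1} (p z)"
      unfolding p_def by (intro continuous_intros)
  qed (use that(2) in \<open>auto intro: pU\<close>)
  have derp: "((\<lambda>z. F (p z t)) has_derivative (\<lambda>h. \<Sum>j\<in>UNIV. (t * cpartial F j (p z t)) * h $ j)) (at z)"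
    if "F \<in> holomorphic_fun U" "z \<in> U" "t \<in> {0..1}" for F z t
  proof -
    have "((\<lambda>z. p z t) has_derivative (\<lambda>h. t *\<^sub>R h)) (at z)"
      unfolding p_def by (auto intro!: derivative_eq_intros)
    from has_derivative_compose[OF this has_derivative_cpartial[OF that(1) pU[OF that(2,3)]]]
    show ?thesis by (simp add: scaleR_conv_of_real[where 'a = complex] mult_ac)
  qed
  define g where "g i z = integral {0..1} (\<lambda>t. cpartial f i (p z t))" for i z
  note hol = holomorphic_fun_cpartial[OF U(1) f]
  show "g i \<in> holomorphic_fun U" for i
    unfolding g_def
  proof (rule holomorphic_fun_integral[OF U(1,2) derp[OF hol]])
    show "continuous_on (U \<times> {0..1}) (\<lambda>(z, t). t * cpartial (cpartial f i) j (p z t))" for j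
      unfolding case_prod_beta
      by (intro continuous_intros contp continuous_on_cpartial[OF U(1) hol])
  qed (auto intro: contp' continuous_on_cpartial[OF U(1) f])
  fix z assume z: "z \<in> U"
  have "((\<lambda>t. \<Sum>i\<in>UNIV. cpartial f i (p z t) * (z $ i - a $ i)) has_integral f (p z 1) - f (p z 0)) {0..1}"
  proof (rule fundamental_theorem_of_calculus)
    fix t :: real assume t: "t \<in> {0..1}"
    have "(p z has_derivative (\<lambda>h. h *\<^sub>R (z - a))) (at t within {0..1})"
      unfolding p_def by (auto intro!: derivative_eq_intros)
    from has_derivative_compose[OF this has_derivative_cpartial[OF f pU[OF z t]]]
    have "((\<lambda>t. f (p z t)) has_derivative (\<lambda>h. \<Sum>j\<in>UNIV. cpartial f j (p z t) * (h *\<^sub>R (z - a)) $ j)) (at t within {0..1})" .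
    then show "((\<lambda>t. f (p z t)) has_vector_derivative (\<Sum>i\<in>UNIV. cpartial f i (p z t) * (z $ i - a $ i))) (at t within {0..1})"
      by (simp add: has_vector_derivative_def scaleR_sum_right)
  qed simp
  moreover have int: "(\<lambda>t. cpartial f i (p z t)) integrable_on {0..1}" for i
    by (intro integrable_continuous_real contp' continuous_on_cpartial[OF U(1) f] z)
  ultimately have "f z - f a = integral {0..1} (\<lambda>t. \<Sum>i\<in>UNIV. cpartial f i (p z t) * (z $ i - a $ i))"
    by (simp add: integral_unique p_def)
  also have "\<dots> = (\<Sum>i\<in>UNIV. (z $ i - a $ i) * g i z)"
    unfolding g_def by (subst integral_sum) (simp_all add: int integrable_on_mult_left mult.commute)
  finally show "f z = f a + (\<Sum>i\<in>UNIV. (z $ i - a $ i) * g i z)"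
    by (simp add: algebra_simps)
qed

section \<open>Complex Hilbert spaces\<close>

lemma scaleC_zero_right [simp]: "a *\<^sub>C (0 :: 'h::complex_hilbert) = 0"
  using scaleC_add_right[of a 0 0] by simp

lemma scaleC_zero_left [simp]: "0 *\<^sub>C (x :: 'h::complex_hilbert) = 0"
  using scaleC_add_left[of 0 0 x] by simp

lemma scaleC_one [simp]: "1 *\<^sub>C (x :: 'h::complex_hilbert) = x"
  using scaleR_scaleC[of 1 x] by simp

lemma scaleC_minus_left: "(- a) *\<^sub>C (x :: 'h::complex_hilbert) = - (a *\<^sub>C x)"
  using scaleC_add_left[of a "- a" x] by (simp add: eq_neg_iff_add_eq_0 add.commute)

lemma scaleC_minus_right: "a *\<^sub>C (- x :: 'h::complex_hilbert) = - (a *\<^sub>C x)"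
  using scaleC_add_right[of a x "- x"] by (simp add: eq_neg_iff_add_eq_0 add.commute)

lemma scaleC_diff_left: "(a - b) *\<^sub>C (x :: 'h::complex_hilbert) = a *\<^sub>C x - b *\<^sub>C x"
  using scaleC_add_left[of a "- b" x] by (simp add: scaleC_minus_left)

lemma scaleC_diff_right: "a *\<^sub>C (x - y :: 'h::complex_hilbert) = a *\<^sub>C x - a *\<^sub>C y"
  using scaleC_add_right[of a x "- y"] by (simp add: scaleC_minus_right)

lemmas scaleC_simps = scaleC_add_left scaleC_add_right scaleC_diff_left scaleC_diff_right
  scaleC_minus_left scaleC_minus_right scaleC_scaleC

lemma scaleC_sum_right: "a *\<^sub>C (\<Sum>i\<in>I. f i :: 'h::complex_hilbert) = (\<Sum>i\<in>I. a *\<^sub>C f i)"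
  by (induction I rule: infinite_finite_induct) (auto simp: scaleC_add_right)

lemma scaleC_sum_left: "(\<Sum>i\<in>I. c i) *\<^sub>C (x :: 'h::complex_hilbert) = (\<Sum>i\<in>I. c i *\<^sub>C x)"
  by (induction I rule: infinite_finite_induct) (auto simp: scaleC_add_left)

lemma cinner_add_right: "cinner x (y + z :: 'h::complex_hilbert) = cinner x y + cinner x z"
  by (metis cinner_add_left cinner_commute complex_cnj_add)

lemma cinner_scaleC_right: "cinner x (a *\<^sub>C y :: 'h::complex_hilbert) = a * cinner x y"
  by (metis cinner_scaleC_left cinner_commute complex_cnj_cnj complex_cnj_mult)

lemma norm_scaleC: "norm (a *\<^sub>C x :: 'h::complex_hilbert) = cmod a * norm x"
proof -
  have "complex_of_real ((norm (a *\<^sub>C x))\<^sup>2) = (a * cnj a) * cinner x x"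
    unfolding cinner_self[symmetric] by (simp add: cinner_scaleC_left cinner_scaleC_right)
  also have "\<dots> = complex_of_real ((cmod a * norm x)\<^sup>2)"
    unfolding cinner_self complex_norm_square[symmetric] by (simp add: power_mult_distrib)
  finally have "complex_of_real ((norm (a *\<^sub>C x))\<^sup>2) = complex_of_real ((cmod a * norm x)\<^sup>2)" .
  then have "(norm (a *\<^sub>C x))\<^sup>2 = (cmod a * norm x)\<^sup>2"
    by (simp only: of_real_eq_iff)
  then show ?thesis by (simp add: power2_eq_iff_nonneg)
qed

lemma bounded_op_scaleC: "bounded_op (\<lambda>x. a *\<^sub>C (x :: 'h::complex_hilbert))"
  unfolding bounded_op_def
proof (intro conjI allI)
  show "bounded_linear (\<lambda>x. a *\<^sub>C (x :: 'h))"
    by (rule bounded_linear_intro[of _ "cmod a"])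
       (simp_all add: scaleC_add_right scaleR_scaleC scaleC_scaleC norm_scaleC mult.commute)
qed (simp add: scaleC_scaleC mult.commute)

section \<open>Koszul complexes\<close>

definition ksign :: "'i::countable \<Rightarrow> 'i set \<Rightarrow> complex" where
  "ksign i S = (- 1) ^ card {j\<in>S. to_nat j < to_nat i}"

lemma ksign_square [simp]: "ksign i S * ksign i S = 1"
  by (simp add: ksign_def flip: power_mult_distrib)

lemma koszul_d_scaleC:
  "koszul_d J T \<omega> S = (if S \<subseteq> J then \<Sum>i\<in>S. ksign i S *\<^sub>C T i (\<omega> (S - {i})) else 0)"
  by (simp add: koszul_d_def ksign_def scaleR_scaleC)

text \<open>For \<open>i\<close> different from \<open>j\<close>, wedging with \<open>j\<close>
  anticommutes with contraction by \<open>i\<close>. In signs: whether \<open>i\<close> is inserted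
  before or after the removal of \<open>j\<close> makes a factor \<open>-1\<close>.\<close>

lemma ksign_swap:
  assumes S: "finite S" "i \<notin> S" "j \<in> S"
  shows "ksign j S * ksign i (insert i (S - {j})) = - (ksign i (insert i S) * ksign j (insert i S))"
proof -
  have ne: "to_nat i \<noteq> to_nat j" using S by auto
  have e: "{k\<in>insert i S. to_nat k < to_nat i} = {k\<in>S. to_nat k < to_nat i}"
    "{k\<in>insert i (S - {j}). to_nat k < to_nat i} = {k\<in>S. to_nat k < to_nat i} - {j}" by auto
  show ?thesis
  proof (cases "to_nat j < to_nat i")
    case True
    then have 1: "{k\<in>insert i S. to_nat k < to_nat j} = {k\<in>S. to_nat k < to_nat j}" by auto
    have 2: "card {k\<in>S. to_nat k < to_nat i} = Suc (card ({k\<in>S. to_nat k < to_nat i} - {j}))"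
      using S True by (intro card.remove) auto
    show ?thesis unfolding ksign_def e 1 2 by simp
  next
    case False
    then have "to_nat i < to_nat j" using ne by linarith
    then have 1: "{k\<in>insert i S. to_nat k < to_nat j} = insert i {k\<in>S. to_nat k < to_nat j}" by auto
    have 2: "{k\<in>S. to_nat k < to_nat i} - {j} = {k\<in>S. to_nat k < to_nat i}"
      using False by auto
    have "card (insert i {k\<in>S. to_nat k < to_nat j}) = Suc (card {k\<in>S. to_nat k < to_nat j})"
      using S by simp
    then show ?thesis unfolding ksign_def e 1 2 by simp
  qed
qed

text \<open>On the range of \<open>E\<close> each \<open>A j\<close> acts as the scalar
  \<open>c j\<close>, and contraction by \<open>i\<close> divided by \<open>c i\<close> is a
  contracting homotopy there. Writing the degree of \<eta> as \<open>Suc (card S) = p\<close> also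
  covers \<open>p = 0\<close>, where it forces \<eta> to vanish.\<close>

lemma koszul_scalar_homotopy:
  fixes A :: "'i::countable \<Rightarrow> 'h::complex_hilbert \<Rightarrow> 'h"
  assumes J: "finite J" "i \<in> J" "c i \<noteq> 0"
    and E: "\<And>x y. E (x + y) = E x + E y" "\<And>a x. E (a *\<^sub>C x) = a *\<^sub>C E x"
    and EA: "\<And>j x. E (A j x) = c j *\<^sub>C E x" "\<And>j x. A j (E x) = c j *\<^sub>C E x"
    and \<omega>: "\<omega> \<in> koszul_cochains J p" "koszul_d J A \<omega> = (\<lambda>_. 0)"
  shows "\<exists>\<eta>. (\<forall>S. \<eta> S \<noteq> 0 \<longrightarrow> S \<subseteq> J \<and> Suc (card S) = p) \<and> koszul_d J A \<eta> = (\<lambda>S. E (\<omega> S))"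
proof -
  have E0: "E 0 = 0" using E(2)[of 0 0] by simp
  have Esum: "E (\<Sum>k\<in>K. f k) = (\<Sum>k\<in>K. E (f k))" for K :: "'i set" and f
    by (induction K rule: infinite_finite_induct) (auto simp: E0 E(1))
  have A0: "A j 0 = 0" for j using EA(2)[of j 0] by (simp add: E0)
  have AE: "A j (a *\<^sub>C E x) = (c j * a) *\<^sub>C E x" for j a x
    using EA(2)[of j "a *\<^sub>C x"] by (simp add: E(2) scaleC_scaleC)
  define \<eta> where "\<eta> S = (if i \<notin> S then E ((ksign i (insert i S) / c i) *\<^sub>C \<omega> (insert i S)) else 0)" for S
  have "S \<subseteq> J \<and> Suc (card S) = p" if "\<eta> S \<noteq> 0" for S
  proof -
    from that have "i \<notin> S" "\<omega> (insert i S) \<noteq> 0" by (auto simp: \<eta>_def E0 split: if_splits)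
    then have "insert i S \<subseteq> J" "card (insert i S) = p"
      using \<omega>(1) by (auto simp: koszul_cochains_def)
    then show ?thesis using \<open>i \<notin> S\<close> J finite_subset[of S J] by auto
  qed
  moreover have "koszul_d J A \<eta> S = E (\<omega> S)" for S
  proof (cases "S \<subseteq> J")
    case False
    then have "\<omega> S = 0" using \<omega>(1) by (auto simp: koszul_cochains_def)
    then show ?thesis using False by (simp add: koszul_d_scaleC E0)
  next
    case SJ: True
    then have fin: "finite S" using J finite_subset by blast
    show ?thesis
    proof (cases "i \<in> S")
      case True
      have "koszul_d J A \<eta> S = (\<Sum>j\<in>S. ksign j S *\<^sub>C A j (\<eta> (S - {j})))"
        using SJ by (simp add: koszul_d_scaleC)
      also have "\<dots> = (\<Sum>j\<in>{i}. ksign j S *\<^sub>C A j (\<eta> (S - {j})))"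
        using fin True by (intro sum.mono_neutral_right) (auto simp: \<eta>_def A0)
      also have "\<dots> = E (\<omega> S)"
      proof -
        have "\<eta> (S - {i}) = (ksign i S / c i) *\<^sub>C E (\<omega> S)"
          using True by (simp add: \<eta>_def E(2) insert_absorb)
        then show ?thesis using J(3) by (simp add: AE scaleC_scaleC)
      qed
      finally show ?thesis .
    next
      case False
      let ?e = "ksign i (insert i S)"
      \<comment> \<open>For \<open>i\<close> outside \<open>S\<close>, closedness of \<omega> is
        used at the larger set \<open>insert i S\<close>: its \<open>i\<close>-th term contains
        \<open>E (\<omega> S)\<close>, and the remaining terms form \<open>?X\<close>.\<close>
      let ?X = "\<Sum>j\<in>S. (ksign j (insert i S) * c j) *\<^sub>C E (\<omega> (insert i S - {j}))"
      have "0 = E (koszul_d J A \<omega> (insert i S))" by (simp add: \<omega>(2) E0)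
      also have "\<dots> = (\<Sum>j\<in>insert i S. (ksign j (insert i S) * c j) *\<^sub>C E (\<omega> (insert i S - {j})))"
        using SJ J by (simp add: koszul_d_scaleC Esum E EA scaleC_scaleC)
      also have "\<dots> = (?e * c i) *\<^sub>C E (\<omega> S) + ?X"
        using fin False by (simp add: sum.insert)
      finally have "(?e * c i) *\<^sub>C E (\<omega> S) + ?X = 0"
        by (rule sym)
      then have X: "?X = - ((?e * c i) *\<^sub>C E (\<omega> S))"
        by (rule minus_unique[symmetric])
      have "koszul_d J A \<eta> S = (\<Sum>j\<in>S. ksign j S *\<^sub>C A j (\<eta> (S - {j})))"
        using SJ by (simp add: koszul_d_scaleC)
      also have "\<dots> = (\<Sum>j\<in>S. (- ?e / c i) *\<^sub>C ((ksign j (insert i S) * c j) *\<^sub>C E (\<omega> (insert i S - {j}))))"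
      proof (rule sum.cong[OF refl])
        fix j assume j: "j \<in> S"
        let ?k = "ksign i (insert i (S - {j}))" and ?x = "E (\<omega> (insert i S - {j}))"
        have "insert i (S - {j}) = insert i S - {j}" using j False by auto
        then have "\<eta> (S - {j}) = (?k / c i) *\<^sub>C ?x"
          using False by (simp add: \<eta>_def E(2))
        then have "ksign j S *\<^sub>C A j (\<eta> (S - {j})) = (ksign j S * (c j * (?k / c i))) *\<^sub>C ?x"
          by (simp only: AE scaleC_scaleC)
        also have "ksign j S * (c j * (?k / c i)) = (ksign j S * ?k) * (c j / c i)"
          by simp
        also have "\<dots> = (- ?e / c i) * (ksign j (insert i S) * c j)"
          unfolding ksign_swap[OF fin False j] by simp
        finally show "ksign j S *\<^sub>C A j (\<eta> (S - {j})) =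
            (- ?e / c i) *\<^sub>C ((ksign j (insert i S) * c j) *\<^sub>C ?x)"
          by (simp only: scaleC_scaleC)
      qed
      also have "\<dots> = (- ?e / c i) *\<^sub>C ?X" by (simp only: scaleC_sum_right)
      also have "\<dots> = E (\<omega> S)"
        unfolding X using J(3) by (simp add: scaleC_minus_right scaleC_minus_left scaleC_scaleC)
      finally show ?thesis .
    qed
  qed
  ultimately show ?thesis by blast
qed

text \<open>A vector killed by all operators is a nonzero closed cochain of degree 0, where
  exactness allows only zero.\<close>

lemma koszul_not_exact_if_joint_kernel:
  fixes A :: "'i::countable \<Rightarrow> 'h::complex_hilbert \<Rightarrow> 'h"
  assumes "x \<noteq> 0" "\<And>j. j \<in> J \<Longrightarrow> A j x = 0" "\<And>j. A j 0 = 0"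
  shows "\<not> koszul_exact J A"
proof
  let ?\<omega> = "\<lambda>S :: 'i set. if S = {} then x else 0"
  assume ex: "koszul_exact J A"
  have "\<omega> = (\<lambda>_. 0)" if "\<omega> \<in> koszul_cochains J 0" "koszul_d J A \<omega> = (\<lambda>_. 0)" for \<omega>
    using ex[unfolded koszul_exact_def, rule_format, OF that] by simp
  moreover have "?\<omega> \<in> koszul_cochains J 0" by (simp add: koszul_cochains_def)
  moreover have "koszul_d J A ?\<omega> = (\<lambda>_. 0)"
  proof
    fix S
    have "A i (?\<omega> (S - {i})) = 0" if "i \<in> J" for i
      using assms(2)[OF that] assms(3) by (cases "S - {i} = {}") auto
    then show "koszul_d J A ?\<omega> S = 0"
      unfolding koszul_d_def by (auto intro!: sum.neutral)
  qed
  ultimately have "?\<omega> = (\<lambda>_. 0)" by blast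
  then have "?\<omega> {} = 0" by (rule fun_cong)
  with \<open>x \<noteq> 0\<close> show False by simp
qed

section \<open>Operators that are diagonal for an idempotent\<close>

locale idempotent_op =
  fixes P :: "'h::complex_hilbert \<Rightarrow> 'h"
  assumes bounded: "bounded_op P"
    and idem: "P (P x) = P x"
    and kernel_nontrivial: "\<exists>x. x \<noteq> 0 \<and> P x = 0"
    and range_nontrivial: "\<exists>x. x \<noteq> 0 \<and> P x = x"
begin

text \<open>The operator acting as \<open>a\<close> on the kernel of \<open>P\<close> and as
  \<open>b\<close> on its range. Such operators are added and composed entrywise in
  \<open>(a, b)\<close>.\<close>

definition D :: "complex \<Rightarrow> complex \<Rightarrow> 'h \<Rightarrow> 'h" where
  "D a b x = a *\<^sub>C x + (b - a) *\<^sub>C P x"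

lemma P_linear: "P (x + y) = P x + P y" "P (x - y) = P x - P y" "P (a *\<^sub>C x) = a *\<^sub>C P x" "P 0 = 0"
  using bounded by (auto simp: bounded_op_def linear_simps)

lemma D_comp: "D a b (D c d x) = D (a * c) (b * d) x"
  by (simp add: D_def P_linear idem scaleC_simps algebra_simps)

lemma D_zero [simp]: "D a b 0 = 0"
  by (simp add: D_def P_linear)

lemma D_scalar: "D a a = (\<lambda>x. a *\<^sub>C x)"
  by (auto simp: D_def)

lemma bounded_op_D: "bounded_op (D a b)"
proof -
  have "bounded_linear (\<lambda>x. a *\<^sub>C x + (b - a) *\<^sub>C P x)"
    using bounded_op_scaleC bounded unfolding bounded_op_def
    by (intro bounded_linear_add) (auto intro: bounded_linear_compose)
  then show ?thesis
    by (simp add: bounded_op_def D_def[abs_def] P_linear scaleC_simps mult.commute)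
qed

lemma D_kernel: "P x = 0 \<Longrightarrow> D a b x = a *\<^sub>C x"
  by (simp add: D_def)

lemma D_range: "P x = x \<Longrightarrow> D a b x = b *\<^sub>C x"
  by (simp add: D_def scaleC_simps)

lemma P_D: "P (D a b x) = b *\<^sub>C P x"
  and D_P: "D a b (P x) = b *\<^sub>C P x"
  and diff_P_D: "D a b x - P (D a b x) = a *\<^sub>C (x - P x)"
  and D_diff_P: "D a b (x - P x) = a *\<^sub>C (x - P x)"
  by (simp_all add: D_def P_linear idem scaleC_simps)

lemma D_add: "D a b (x + y) = D a b x + D a b y"
  by (simp add: D_def P_linear scaleC_simps)

text \<open>The space is the direct sum of kernel and range of \<open>P\<close>, and on each summand
  the tuple consists of scalars. A Koszul complex of scalars on a nonzero space is exact precisely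
  when some scalar is nonzero.\<close>

lemma koszul_exact_D:
  fixes J :: "'i::countable set"
  assumes J: "finite J"
  shows "koszul_exact J (\<lambda>j. D (a j) (b j)) \<longleftrightarrow> (\<exists>j\<in>J. a j \<noteq> 0) \<and> (\<exists>j\<in>J. b j \<noteq> 0)"
proof safe
  let ?A = "\<lambda>j. D (a j) (b j)"
  assume ex: "koszul_exact J ?A"
  show "\<exists>j\<in>J. a j \<noteq> 0"
  proof (rule ccontr)
    assume *: "\<not> ?thesis"
    obtain x where "x \<noteq> 0" "P x = 0" using kernel_nontrivial by blast
    with * have "\<not> koszul_exact J ?A"
      by (intro koszul_not_exact_if_joint_kernel[of x]) (auto simp: D_kernel)
    with ex show False by blast
  qed
  show "\<exists>j\<in>J. b j \<noteq> 0"
  proof (rule ccontr)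
    assume *: "\<not> ?thesis"
    obtain x where "x \<noteq> 0" "P x = x" using range_nontrivial by blast
    with * have "\<not> koszul_exact J ?A"
      by (intro koszul_not_exact_if_joint_kernel[of x]) (auto simp: D_range)
    with ex show False by blast
  qed
next
  fix i k assume i: "i \<in> J" "a i \<noteq> 0" and k: "k \<in> J" "b k \<noteq> 0"
  let ?A = "\<lambda>j. D (a j) (b j)"
  show "koszul_exact J ?A"
    unfolding koszul_exact_def
  proof safe
    fix p \<omega> assume \<omega>: "\<omega> \<in> koszul_cochains J p" "koszul_d J ?A \<omega> = (\<lambda>_. 0)"
    \<comment> \<open>The homotopy is applied with the complementary idempotents
      \<open>I - P\<close> and \<open>P\<close>; adding the two primitives gives a primitive of
      \<omega>.\<close>
    have "\<exists>\<eta>. (\<forall>S. \<eta> S \<noteq> 0 \<longrightarrow> S \<subseteq> J \<and> Suc (card S) = p) \<and> koszul_d J ?A \<eta> = (\<lambda>S. \<omega> S - P (\<omega> S))"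
      by (rule koszul_scalar_homotopy[where c = a, OF J i _ _ diff_P_D D_diff_P \<omega>])
         (simp_all add: P_linear scaleC_simps)
    then obtain \<eta>1 where \<eta>1: "\<forall>S. \<eta>1 S \<noteq> 0 \<longrightarrow> S \<subseteq> J \<and> Suc (card S) = p"
        "koszul_d J ?A \<eta>1 = (\<lambda>S. \<omega> S - P (\<omega> S))" by blast
    have "\<exists>\<eta>. (\<forall>S. \<eta> S \<noteq> 0 \<longrightarrow> S \<subseteq> J \<and> Suc (card S) = p) \<and> koszul_d J ?A \<eta> = (\<lambda>S. P (\<omega> S))"
      by (rule koszul_scalar_homotopy[where c = b, OF J k _ _ P_D D_P \<omega>]) (simp_all add: P_linear)
    then obtain \<eta>2 where \<eta>2: "\<forall>S. \<eta>2 S \<noteq> 0 \<longrightarrow> S \<subseteq> J \<and> Suc (card S) = p"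
        "koszul_d J ?A \<eta>2 = (\<lambda>S. P (\<omega> S))" by blast
    define \<eta> where "\<eta> S = \<eta>1 S + \<eta>2 S" for S
    have "koszul_d J ?A \<eta> S = koszul_d J ?A \<eta>1 S + koszul_d J ?A \<eta>2 S" for S
      by (simp add: koszul_d_scaleC \<eta>_def D_add scaleC_add_right sum.distrib)
    then have d: "koszul_d J ?A \<eta> = \<omega>" by (auto simp: \<eta>1 \<eta>2)
    have \<eta>: "\<forall>S. \<eta> S \<noteq> 0 \<longrightarrow> S \<subseteq> J \<and> Suc (card S) = p"
      using \<eta>1(1) \<eta>2(1) by (metis \<eta>_def add.right_neutral)
    show "case p of 0 \<Rightarrow> \<omega> = (\<lambda>_. 0) | Suc q \<Rightarrow> \<omega> \<in> koszul_d J ?A ` koszul_cochains J q"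
    proof (cases p)
      case 0
      with \<eta> have "\<eta> = (\<lambda>_. 0)" by auto
      with d have "\<omega> = (\<lambda>_. 0)" by (auto simp: koszul_d_def)
      with 0 show ?thesis by simp
    next
      case (Suc q)
      with \<eta> have "\<eta> \<in> koszul_cochains J q" by (auto simp: koszul_cochains_def)
      with d Suc show ?thesis by auto
    qed
  qed
qed

section \<open>The Taylor functional calculus of a diagonal tuple\<close>

context
  fixes z w :: "complex ^ 'd" and T
  defines "T \<equiv> \<lambda>j. D (z $ j) (w $ j)"
begin

lemma commuting_tuple_D: "commuting_tuple T"
  by (auto simp: commuting_tuple_def T_def bounded_op_D fun_eq_iff D_comp mult.commute)

lemma taylor_spectrum_D: "taylor_spectrum T = {z, w}"
proof -
  have "(\<lambda>j x. (\<zeta> $ j) *\<^sub>C x - T j x) = (\<lambda>j. D (\<zeta> $ j - z $ j) (\<zeta> $ j - w $ j))" for \<zeta>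
    by (simp add: T_def D_def fun_eq_iff scaleC_simps algebra_simps)
  then show ?thesis
    by (auto simp: taylor_spectrum_def koszul_exact_D vec_eq_iff)
qed

lemma op_monomial_D:
  "op_monomial m T = D (\<Prod>i\<in>UNIV. (z $ i) ^ Poly_Mapping.lookup m i) (\<Prod>i\<in>UNIV. (w $ i) ^ Poly_Mapping.lookup m i)"
proof -
  have pow: "T i ^^ k = D (z $ i ^ k) (w $ i ^ k)" for i k
    by (induction k) (auto simp: fun_eq_iff T_def D_comp D_scalar)
  interpret comp_fun_commute "\<lambda>i A. (T i ^^ Poly_Mapping.lookup m i) \<circ> A"
    by standard (simp add: pow fun_eq_iff D_comp mult.commute)
  have "Finite_Set.fold (\<lambda>i A. (T i ^^ Poly_Mapping.lookup m i) \<circ> A) id I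
      = D (\<Prod>i\<in>I. (z $ i) ^ Poly_Mapping.lookup m i) (\<Prod>i\<in>I. (w $ i) ^ Poly_Mapping.lookup m i)"
    if "finite I" for I
    using that
  proof induction
    case (insert x F)
    show ?case
      unfolding fold_insert[OF insert.hyps] insert.IH
      using insert.hyps by (simp add: pow fun_eq_iff D_comp)
  qed (simp add: D_scalar fun_eq_iff)
  from this[of UNIV] show ?thesis by (simp add: op_monomial_def)
qed

lemma op_poly_D: "op_poly p T = D (cpoly_eval p z) (cpoly_eval p w)"
proof
  fix x
  show "op_poly p T x = D (cpoly_eval p z) (cpoly_eval p w) x"
    by (simp add: op_poly_def op_monomial_D cpoly_eval_def D_def scaleC_simps scaleC_sum_left
        sum.distrib sum_subtractf)
qed

text \<open>The algebraic conditions hold because \<open>D\<close> is additive and multiplicative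
  entrywise. Continuity reduces to convergence at the two points, and the spectral mapping property
  is \<open>koszul_exact_D\<close> for the differences \<open>\<mu> j - F j\<close>.\<close>

lemma is_taylor_calculus_D: "is_taylor_calculus T (\<lambda>U f. D (f z) (f w))"
  unfolding is_taylor_calculus_def taylor_spectrum_D
proof (intro allI impI conjI ballI, goal_cases)
  case (7 U F f)
  then have U: "open U \<and> {z, w} \<subseteq> U" and F: "(\<forall>n. F n \<in> holomorphic_fun U) \<and>
            (\<forall>K. compact K \<and> K \<subseteq> U \<longrightarrow> uniform_limit K F f sequentially)"
    by auto
  have lim: "(\<lambda>n. F n u) \<longlonglongrightarrow> f u" if "u \<in> {z, w}" for u
  proof -
    have "uniform_limit {z, w} F f sequentially"
      using F U by (simp add: finite_imp_compact)
    from tendsto_uniform_limitI[OF this that] show ?thesis .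
  qed
  have bl: "bounded_linear P" using bounded by (simp add: bounded_op_def)
  let ?a = "\<lambda>n. F n z - f z" and ?b = "\<lambda>n. F n w - f w"
  have le: "onorm (\<lambda>x. D (F n z) (F n w) x - D (f z) (f w) x) \<le> cmod (?a n) + cmod (?b n - ?a n) * onorm P" for n
  proof (rule onorm_bound)
    show "0 \<le> cmod (?a n) + cmod (?b n - ?a n) * onorm P"
      using onorm_pos_le[OF bl] by simp
    fix x
    have "D (F n z) (F n w) x - D (f z) (f w) x = ?a n *\<^sub>C x + (?b n - ?a n) *\<^sub>C P x"
      by (simp add: D_def scaleC_simps algebra_simps)
    then have "norm (D (F n z) (F n w) x - D (f z) (f w) x)
        \<le> cmod (?a n) * norm x + cmod (?b n - ?a n) * norm (P x)"
      by (metis norm_scaleC norm_triangle_ineq)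
    also have "\<dots> \<le> cmod (?a n) * norm x + cmod (?b n - ?a n) * (onorm P * norm x)"
      by (intro add_left_mono mult_left_mono onorm[OF bl]) simp
    finally show "norm (D (F n z) (F n w) x - D (f z) (f w) x)
        \<le> (cmod (?a n) + cmod (?b n - ?a n) * onorm P) * norm x"
      by (simp add: algebra_simps)
  qed
  have ge: "0 \<le> onorm (\<lambda>x. D (F n z) (F n w) x - D (f z) (f w) x)" for n
    using bounded_op_D unfolding bounded_op_def by (intro onorm_pos_le bounded_linear_sub) blast+
  have "?a \<longlonglongrightarrow> 0" "?b \<longlonglongrightarrow> 0"
    using lim by (auto simp: LIM_zero_iff)
  then have "(\<lambda>n. cmod (?a n) + cmod (?b n - ?a n) * onorm P) \<longlonglongrightarrow> cmod 0 + cmod (0 - 0) * onorm P"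
    by (intro tendsto_intros)
  then have lim0: "(\<lambda>n. cmod (?a n) + cmod (?b n - ?a n) * onorm P) \<longlonglongrightarrow> 0"
    by simp
  show ?case
    by (rule tendsto_sandwich[OF always_eventually always_eventually tendsto_const lim0])
       (intro allI le ge)+
next
  case (9 U m F \<mu>)
  have "(\<lambda>j x. \<mu> j *\<^sub>C x - D (F j z) (F j w) x) = (\<lambda>j. D (\<mu> j - F j z) (\<mu> j - F j w))"
    by (simp add: D_def fun_eq_iff scaleC_simps)
  then show ?case
    by (auto simp: koszul_exact_D)
next
  case (1 U f)
  show ?case by (rule bounded_op_D)
next
  case (2 U)
  show ?case by (simp add: D_scalar fun_eq_iff)
next
  case (3 U i)
  show ?case by (simp add: T_def)
next
  case (4 U f g)
  show ?case by (simp add: D_def fun_eq_iff scaleC_simps)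
next
  case (5 U f g)
  show ?case by (simp add: D_comp fun_eq_iff)
next
  case (6 U f c)
  show ?case by (simp add: D_def fun_eq_iff scaleC_simps right_diff_distrib)
next
  case (8 U V f g)
  then show ?case by auto
qed

text \<open>
  Subtracting an affine function we may assume that \<open>f\<close> vanishes at \<open>z\<close> and \<open>w\<close>. By Hadamard's
  lemma it then lies, near \<open>{z, w}\<close>, in the ideal generated by the products
  \<open>(\<zeta> $ i - z $ i) * (\<zeta> $ k - w $ k)\<close> and \<open>(\<zeta> $ i - w $ i) * (\<zeta> $ k - z $ k)\<close>, which every
  calculus sends to \<open>0\<close>.
\<close>

lemma taylor_calculus_D_unique:
  assumes zw: "z \<noteq> w" and U: "open U" "{z, w} \<subseteq> U" and f: "f \<in> holomorphic_fun U"
    and \<Theta>: "is_taylor_calculus T \<Theta>"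
  shows "\<Theta> U f = D (f z) (f w)"
proof -
  obtain k where k: "z $ k \<noteq> w $ k" using zw by (auto simp: vec_eq_iff)
  obtain e1 where e1: "e1 > 0" "ball z e1 \<subseteq> U" using U by (meson insert_subset open_contains_ball)
  obtain e2 where e2: "e2 > 0" "ball w e2 \<subseteq> U" using U by (meson insert_subset open_contains_ball)
  \<comment> \<open>Half of the distance in the separating coordinate \<open>k\<close> makes the two
    balls disjoint and keeps \<open>\<zeta> $ k - w $ k\<close> away from zero on the ball around
    \<open>z\<close>, and symmetrically.\<close>
  define e where "e = min (min e1 e2) (cmod (w $ k - z $ k) / 2)"
  have e: "e > 0" using e1 e2 k by (simp add: e_def)
  define Bz Bw where "Bz = ball z e" and "Bw = ball w e"
  \<comment> \<open>On a union of disjoint balls, functions holomorphic on each ball may be glued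
    freely. Compatibility with restriction moves the computation from \<open>U\<close> to
    \<open>V\<close>.\<close>
  define V where "V = Bz \<union> Bw"
  have VU: "V \<subseteq> U" using e1 e2 by (auto simp: V_def Bz_def Bw_def e_def)
  have openV: "open V" "open Bz" "open Bw" and zwV: "{z, w} \<subseteq> V" and "z \<in> Bz" "w \<in> Bw"
    using e by (auto simp: V_def Bz_def Bw_def)
  have near: "cmod (\<zeta> $ k - a $ k) < cmod (w $ k - z $ k) / 2" if "\<zeta> \<in> ball a e" for \<zeta> a
  proof -
    have "cmod ((\<zeta> - a) $ k) \<le> norm (\<zeta> - a)" by (rule Finite_Cartesian_Product.norm_nth_le)
    also have "\<dots> < e" using that by (simp add: dist_norm norm_minus_commute)
    also have "e \<le> cmod (w $ k - z $ k) / 2" by (simp add: e_def)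
    finally show ?thesis by simp
  qed
  have nez: "\<zeta> $ k \<noteq> w $ k" if "\<zeta> \<in> Bz" for \<zeta>
    using near[of \<zeta> z] that k by (auto simp: Bz_def)
  have new: "\<zeta> $ k \<noteq> z $ k" if "\<zeta> \<in> Bw" for \<zeta>
    using near[of \<zeta> w] that k by (auto simp: Bw_def norm_minus_commute)
  have disj: "\<zeta> \<notin> Bw" if "\<zeta> \<in> Bz" for \<zeta>
  proof
    assume "\<zeta> \<in> Bw"
    then have "cmod (\<zeta> $ k - z $ k) + cmod (\<zeta> $ k - w $ k) < cmod (w $ k - z $ k)"
      using near[of \<zeta> z] near[of \<zeta> w] that by (simp add: Bz_def Bw_def)
    moreover have "cmod (w $ k - z $ k) \<le> cmod (\<zeta> $ k - z $ k) + cmod (\<zeta> $ k - w $ k)"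
      using norm_triangle_ineq4[of "\<zeta> $ k - z $ k" "\<zeta> $ k - w $ k"] by simp
    ultimately show False by simp
  qed

  define \<theta> where "\<theta> = \<Theta> V"
  have V: "open V \<and> {z, w} \<subseteq> V" using openV zwV by simp
  note calc = \<Theta>[unfolded is_taylor_calculus_def taylor_spectrum_D, THEN spec, THEN mp]
  note calcs = calc[OF V, folded \<theta>_def, THEN conjunct2]
  note calcs2 = calcs[THEN conjunct2, THEN conjunct2]
  have one: "\<theta> (\<lambda>_. 1) = id"
    by (rule calcs[THEN conjunct1])
  have coord: "\<theta> (\<lambda>\<zeta>. \<zeta> $ i) = T i" for i
    by (rule calcs[THEN conjunct2, THEN conjunct1, THEN spec])
  have add: "\<theta> (\<lambda>\<zeta>. f \<zeta> + g \<zeta>) = (\<lambda>x. \<theta> f x + \<theta> g x)"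
    if "f \<in> holomorphic_fun V" "g \<in> holomorphic_fun V" for f g
    by (rule calcs2[THEN conjunct1, THEN bspec, THEN bspec, OF that])
  have mult: "\<theta> (\<lambda>\<zeta>. f \<zeta> * g \<zeta>) = \<theta> f \<circ> \<theta> g"
    if "f \<in> holomorphic_fun V" "g \<in> holomorphic_fun V" for f g
    by (rule calcs2[THEN conjunct2, THEN conjunct1, THEN bspec, THEN bspec, OF that])
  have smult: "\<theta> (\<lambda>\<zeta>. c * f \<zeta>) = (\<lambda>x. c *\<^sub>C \<theta> f x)" if "f \<in> holomorphic_fun V" for f c
    by (rule calcs2[THEN conjunct2, THEN conjunct2, THEN conjunct1, THEN bspec, THEN spec, OF that])
  have U': "open U \<and> {z, w} \<subseteq> U" using U by simp
  have restrict: "\<Theta> U f = \<theta> g" if "g \<in> holomorphic_fun V" "\<And>\<zeta>. \<zeta> \<in> V \<Longrightarrow> f \<zeta> = g \<zeta>" for g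
    unfolding \<theta>_def
    by (rule calc[OF U', THEN conjunct2, THEN conjunct2, THEN conjunct2, THEN conjunct2, THEN conjunct2,
          THEN conjunct2, THEN conjunct2, THEN conjunct1, rule_format])
       (use V VU f that in auto)
  note hol = holomorphic_fun_intros
  have const: "\<theta> (\<lambda>_. c) = (\<lambda>x. c *\<^sub>C x)" for c
    using smult[OF hol(1)[of 1], of c] by (simp add: one)
  have affine: "\<theta> (\<lambda>\<zeta>. c * \<zeta> $ i + d) = D (c * z $ i + d) (c * w $ i + d)" for c i d
  proof -
    have "\<theta> (\<lambda>\<zeta>. c * \<zeta> $ i + d) = (\<lambda>x. c *\<^sub>C T i x + d *\<^sub>C x)"
      by (subst add) (intro hol, intro hol, simp add: smult[OF hol(2)] coord const)
    then show ?thesis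
      by (simp add: T_def D_def fun_eq_iff scaleC_simps right_diff_distrib)
  qed
  \<comment> \<open>One linear factor goes to an operator vanishing on the kernel of the idempotent,
    the other to one vanishing on its range, so their composition is zero.\<close>
  have null: "\<theta> (\<lambda>\<zeta>. ((\<zeta> $ i - a $ i) * (\<zeta> $ k - b $ k)) * g \<zeta>) = (\<lambda>_. 0)"
    if "g \<in> holomorphic_fun V" "(a, b) = (z, w) \<or> (a, b) = (w, z)" for g i a b
  proof -
    let ?p = "\<lambda>\<zeta>. 1 * \<zeta> $ i + (- a $ i)" and ?q = "\<lambda>\<zeta>. 1 * \<zeta> $ k + (- b $ k)"
    have pq: "?p \<in> holomorphic_fun V" "?q \<in> holomorphic_fun V" by (intro hol)+
    have "\<theta> (\<lambda>\<zeta>. (?p \<zeta> * ?q \<zeta>) * g \<zeta>) = (\<theta> ?p \<circ> \<theta> ?q) \<circ> \<theta> g"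
      using mult[OF holomorphic_fun_mult[OF pq] that(1)] mult[OF pq] by simp
    also have "\<dots> = (\<lambda>_. 0)"
      using that(2) unfolding affine by (auto simp: fun_eq_iff D_comp D_scalar)
    finally have "\<theta> (\<lambda>\<zeta>. (?p \<zeta> * ?q \<zeta>) * g \<zeta>) = (\<lambda>_. 0)" .
    then show ?thesis by simp
  qed
  have sum_null: "\<theta> (\<lambda>\<zeta>. \<Sum>i\<in>I. G i \<zeta>) = (\<lambda>_. 0)"
    if "\<And>i. G i \<in> holomorphic_fun V" "\<And>i. \<theta> (G i) = (\<lambda>_. 0)" for G and I :: "'d set"
    using finite[of I]
  proof induction
    case (insert i I)
    then show ?case by (simp add: add[OF that(1) holomorphic_fun_sum] that)
  qed (simp add: const)

  \<comment> \<open>The affine function of the separating coordinate that interpolates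
    \<open>f\<close> at \<open>z\<close> and \<open>w\<close>.\<close>
  define c where "c = (f w - f z) / (w $ k - z $ k)"
  define d where "d = f z - c * z $ k"
  have cd: "c * z $ k + d = f z" "c * w $ k + d = f w"
  proof -
    have "c * (w $ k - z $ k) = f w - f z" using k by (simp add: c_def)
    then show "c * z $ k + d = f z" "c * w $ k + d = f w"
      by (simp_all add: d_def algebra_simps)
  qed
  define F where "F \<zeta> = f \<zeta> - (c * \<zeta> $ k + d)" for \<zeta>
  have F: "F \<in> holomorphic_fun Bz" "F \<in> holomorphic_fun Bw" and F0: "F z = 0" "F w = 0"
    using f VU unfolding F_def by (auto intro!: hol intro: holomorphic_fun_subset simp: V_def cd)
  obtain g where g: "\<And>i. g i \<in> holomorphic_fun Bz"
    "\<And>\<zeta>. \<zeta> \<in> Bz \<Longrightarrow> F \<zeta> = F z + (\<Sum>i\<in>UNIV. (\<zeta> $ i - z $ i) * g i \<zeta>)"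
    using holomorphic_fun_Hadamard[OF openV(2) _ \<open>z \<in> Bz\<close> F(1)] by (auto simp: Bz_def)
  obtain h where h: "\<And>i. h i \<in> holomorphic_fun Bw"
    "\<And>\<zeta>. \<zeta> \<in> Bw \<Longrightarrow> F \<zeta> = F w + (\<Sum>i\<in>UNIV. (\<zeta> $ i - w $ i) * h i \<zeta>)"
    using holomorphic_fun_Hadamard[OF openV(3) _ \<open>w \<in> Bw\<close> F(2)] by (auto simp: Bw_def)
  \<comment> \<open>The quotient cancels the factor \<open>\<zeta> $ k - w $ k\<close> put into
    \<open>QA\<close> below, so that \<open>QA\<close> reproduces the Hadamard terms near
    \<open>z\<close>; the value 0 near \<open>w\<close> keeps it out of the other expansion.
    \<open>B\<close> is its mirror image.\<close>
  define A where "A i \<zeta> = (if \<zeta> \<in> Bz then g i \<zeta> / (\<zeta> $ k - w $ k) else 0)" for i \<zeta>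
  define B where "B i \<zeta> = (if \<zeta> \<in> Bw then h i \<zeta> / (\<zeta> $ k - z $ k) else 0)" for i \<zeta>
  have glue: "G \<in> holomorphic_fun V" if "G \<in> holomorphic_fun Bz" "G \<in> holomorphic_fun Bw" for G
    using that by (auto simp: holomorphic_fun_def V_def)
  have A: "A i \<in> holomorphic_fun V" for i
  proof (rule glue)
    have "(\<lambda>\<zeta>. g i \<zeta> / (\<zeta> $ k - w $ k)) \<in> holomorphic_fun Bz"
      by (intro holomorphic_fun_divide g hol) (use nez in auto)
    then show "A i \<in> holomorphic_fun Bz"
      by (rule holomorphic_fun_cong[OF openV(2)]) (simp add: A_def)
    show "A i \<in> holomorphic_fun Bw"
      by (rule holomorphic_fun_cong[OF openV(3) hol(1)[of 0]]) (use disj in \<open>auto simp: A_def\<close>)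
  qed
  have B: "B i \<in> holomorphic_fun V" for i
  proof (rule glue)
    have "(\<lambda>\<zeta>. h i \<zeta> / (\<zeta> $ k - z $ k)) \<in> holomorphic_fun Bw"
      by (intro holomorphic_fun_divide h hol) (use new in auto)
    then show "B i \<in> holomorphic_fun Bw"
      by (rule holomorphic_fun_cong[OF openV(3)]) (simp add: B_def)
    show "B i \<in> holomorphic_fun Bz"
      by (rule holomorphic_fun_cong[OF openV(2) hol(1)[of 0]]) (use disj in \<open>auto simp: B_def\<close>)
  qed
  define QA where "QA i \<zeta> = ((\<zeta> $ i - z $ i) * (\<zeta> $ k - w $ k)) * A i \<zeta>" for i \<zeta>
  define QB where "QB i \<zeta> = ((\<zeta> $ i - w $ i) * (\<zeta> $ k - z $ k)) * B i \<zeta>" for i \<zeta>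
  have Q: "QA i \<in> holomorphic_fun V" "QB i \<in> holomorphic_fun V"
    "\<theta> (QA i) = (\<lambda>_. 0)" "\<theta> (QB i) = (\<lambda>_. 0)" for i
    unfolding QA_def QB_def by (intro hol A B null; simp)+
  have "f \<zeta> = (c * \<zeta> $ k + d) + ((\<Sum>i\<in>UNIV. QA i \<zeta>) + (\<Sum>i\<in>UNIV. QB i \<zeta>))" if "\<zeta> \<in> V" for \<zeta>
  proof -
    have "F \<zeta> = (\<Sum>i\<in>UNIV. QA i \<zeta>) + (\<Sum>i\<in>UNIV. QB i \<zeta>)"
    proof (cases "\<zeta> \<in> Bz")
      case True
      then have "QA i \<zeta> = (\<zeta> $ i - z $ i) * g i \<zeta>" "QB i \<zeta> = 0" for i
        using nez[OF True] disj[OF True] by (simp_all add: QA_def QB_def A_def B_def)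
      then show ?thesis using g(2)[OF True] F0 by simp
    next
      case False
      then have w: "\<zeta> \<in> Bw" using that by (simp add: V_def)
      then have "QB i \<zeta> = (\<zeta> $ i - w $ i) * h i \<zeta>" "QA i \<zeta> = 0" for i
        using new[OF w] False by (simp_all add: QA_def QB_def A_def B_def)
      then show ?thesis using h(2)[OF w] F0 by simp
    qed
    then show ?thesis by (simp add: F_def algebra_simps)
  qed
  then have "\<Theta> U f = \<theta> (\<lambda>\<zeta>. (c * \<zeta> $ k + d) + ((\<Sum>i\<in>UNIV. QA i \<zeta>) + (\<Sum>i\<in>UNIV. QB i \<zeta>)))"
    by (intro restrict hol Q)
  also have "\<dots> = (\<lambda>x. \<theta> (\<lambda>\<zeta>. c * \<zeta> $ k + d) x
      + (\<theta> (\<lambda>\<zeta>. \<Sum>i\<in>UNIV. QA i \<zeta>) x + \<theta> (\<lambda>\<zeta>. \<Sum>i\<in>UNIV. QB i \<zeta>) x))"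
    by (subst add, (intro hol Q)+, subst add, (intro hol Q)+, rule refl)
  also have "\<dots> = D (f z) (f w)"
    by (simp add: sum_null Q affine cd)
  finally show ?thesis .
qed

lemma taylor_fc_D:
  assumes "z \<noteq> w" "open U" "{z, w} \<subseteq> U" "f \<in> holomorphic_fun U"
  shows "taylor_fc T U f = D (f z) (f w)"
  unfolding taylor_fc_def
proof (rule the_equality)
  show "\<exists>\<Theta>. is_taylor_calculus T \<Theta> \<and> D (f z) (f w) = \<Theta> U f"
    using is_taylor_calculus_D by (intro exI[of _ "\<lambda>U f. D (f z) (f w)"]) simp
qed (use taylor_calculus_D_unique[OF assms] in blast)

end

end

section \<open>Oblique projections\<close>

lemma cinner_diff_right: "cinner x (y - z :: 'h::complex_hilbert) = cinner x y - cinner x z"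
proof -
  have "cinner x (- z) = - cinner x z"
    using cinner_scaleC_right[of x "- 1" z] by (simp add: scaleC_minus_left)
  then show ?thesis
    using cinner_add_right[of x y "- z"] by simp
qed

lemma cinner_zero_right [simp]: "cinner x (0 :: 'h::complex_hilbert) = 0"
  using cinner_add_right[of x 0 0] by simp

lemma cinner_sum_right: "cinner x (\<Sum>i\<in>I. f i :: 'h::complex_hilbert) = (\<Sum>i\<in>I. cinner x (f i))"
  by (induction I rule: infinite_finite_induct) (auto simp: cinner_add_right)

lemma cinner_sum_left: "cinner (\<Sum>i\<in>I. f i :: 'h::complex_hilbert) x = (\<Sum>i\<in>I. cinner (f i) x)"
  by (subst cinner_commute) (simp add: cinner_sum_right flip: cinner_commute)

lemma norm_square_Re_cinner: "(norm (x :: 'h::complex_hilbert))\<^sup>2 = Re (cinner x x)"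
  by (simp add: cinner_self)

lemma norm_normalized: "x \<noteq> 0 \<Longrightarrow> norm ((1 / of_real (norm x)) *\<^sub>C x :: 'h::complex_hilbert) = 1"
  by (simp add: norm_scaleC norm_divide)

text \<open>Gram-Schmidt: infinite dimension is applied to the finite sets \<open>{}\<close> and
  \<open>{v}\<close>, neither of which spans.\<close>

lemma exists_orthonormal_pair:
  assumes "separable_infinite_dim TYPE('h::complex_hilbert)"
  obtains v e :: "'h::complex_hilbert" where "norm v = 1" "norm e = 1" "cinner v e = 0"
proof -
  have inf: "\<exists>x. \<forall>c. x \<noteq> (\<Sum>b\<in>B. c b *\<^sub>C b)" if "finite B" for B :: "'h set"
    using assms that unfolding separable_infinite_dim_def by blast
  from inf[of "{}"] obtain x :: 'h where "x \<noteq> 0" by auto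
  define v where "v = (1 / of_real (norm x)) *\<^sub>C x"
  have v: "norm v = 1" unfolding v_def by (rule norm_normalized) fact
  from inf[of "{v}"] obtain y where y: "\<forall>c. y \<noteq> c v *\<^sub>C v" by auto
  define u where "u = y - cinner v y *\<^sub>C v"
  have "u \<noteq> 0" using y[rule_format, of "\<lambda>_. cinner v y"] by (simp add: u_def)
  have "cinner v u = 0"
    by (simp add: u_def cinner_diff_right cinner_scaleC_right cinner_self v)
  then show ?thesis
    using that[of v "(1 / of_real (norm u)) *\<^sub>C u"] v norm_normalized[OF \<open>u \<noteq> 0\<close>]
    by (simp add: cinner_scaleC_right)
qed

locale orthonormal_pair =
  fixes v e :: "'h::complex_hilbert"
  assumes norm_v: "norm v = 1" and norm_e: "norm e = 1" and orth: "cinner v e = 0"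
begin

lemma cinner_ve [simp]: "cinner v v = 1" "cinner e e = 1" "cinner v e = 0" "cinner e v = 0"
  using orth cinner_commute[of e v] by (simp_all add: cinner_self norm_v norm_e)

definition rest :: "'h \<Rightarrow> 'h" where
  "rest x = x - cinner v x *\<^sub>C v - cinner e x *\<^sub>C e"

lemma decompose: "x = cinner v x *\<^sub>C v + cinner e x *\<^sub>C e + rest x"
  by (simp add: rest_def)

lemma cinner_rest [simp]: "cinner v (rest x) = 0" "cinner e (rest x) = 0"
  by (simp_all add: rest_def cinner_diff_right cinner_scaleC_right)

lemma norm_square_decomposed:
  assumes "cinner v r = 0" "cinner e r = 0"
  shows "(norm (a *\<^sub>C v + b *\<^sub>C e + r))\<^sup>2 = (cmod a)\<^sup>2 + (cmod b)\<^sup>2 + (norm r)\<^sup>2"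
proof -
  have r: "cinner r v = 0" "cinner r e = 0"
    using assms cinner_commute[of r v] cinner_commute[of r e] by simp_all
  have "cinner (a *\<^sub>C v + b *\<^sub>C e + r) (a *\<^sub>C v + b *\<^sub>C e + r) = a * cnj a + b * cnj b + cinner r r"
    by (simp add: cinner_add_left cinner_add_right cinner_scaleC_left cinner_scaleC_right assms r)
  then show ?thesis
    by (simp add: norm_square_Re_cinner complex_mult_cnj cmod_power2)
qed

lemma norm_square_decompose:
  "(norm x)\<^sup>2 = (cmod (cinner v x))\<^sup>2 + (cmod (cinner e x))\<^sup>2 + (norm (rest x))\<^sup>2"
  using norm_square_decomposed[of "rest x" "cinner v x" "cinner e x"]
  unfolding decompose[symmetric] by simp

lemma cinner_bounds: "cmod (cinner v x) \<le> norm x" "cmod (cinner e x) \<le> norm x"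
proof -
  have "(cmod (cinner v x))\<^sup>2 \<le> (norm x)\<^sup>2" "(cmod (cinner e x))\<^sup>2 \<le> (norm x)\<^sup>2"
    unfolding norm_square_decompose[of x] by simp_all
  then show "cmod (cinner v x) \<le> norm x" "cmod (cinner e x) \<le> norm x"
    by (auto intro: power2_le_imp_le)
qed

text \<open>Its kernel consists of the multiples of \<open>s v - e\<close> plus the orthogonal
  complement of \<open>v\<close> and \<open>e\<close>.\<close>

definition proj :: "real \<Rightarrow> 'h \<Rightarrow> 'h" where
  "proj s x = (cinner v x + s * cinner e x) *\<^sub>C v"

lemma bounded_op_proj: "bounded_op (proj s)"
  unfolding bounded_op_def
proof (intro conjI allI)
  show "bounded_linear (proj s)"
  proof (rule bounded_linear_intro)
    fix x
    have "cmod (cinner v x + s * cinner e x) \<le> cmod (cinner v x) + \<bar>s\<bar> * cmod (cinner e x)"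
      using norm_triangle_ineq[of "cinner v x" "s * cinner e x"] by (simp add: norm_mult)
    also have "\<dots> \<le> norm x + \<bar>s\<bar> * norm x"
      by (intro add_mono mult_left_mono cinner_bounds) simp
    finally show "norm (proj s x) \<le> norm x * (1 + \<bar>s\<bar>)"
      by (simp add: proj_def norm_scaleC norm_v algebra_simps)
  qed (simp_all add: proj_def cinner_add_right scaleC_add_left scaleC_add_right cinner_scaleC_right scaleR_scaleC
      scaleC_scaleC distrib_left distrib_right mult.left_commute)
  show "proj s (a *\<^sub>C x) = a *\<^sub>C proj s x" for a x
    by (simp add: proj_def cinner_scaleC_right scaleC_scaleC distrib_left mult.left_commute)
qed

sublocale idempotent_op "proj s" for s
proof
  show "bounded_op (proj s)" by (rule bounded_op_proj)
  show "proj s (proj s x) = proj s x" for x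
    by (simp add: proj_def cinner_scaleC_right)
  have "cinner e (of_real s *\<^sub>C v - e) = - 1"
    by (simp add: cinner_diff_right cinner_scaleC_right)
  then have "of_real s *\<^sub>C v - e \<noteq> 0" by auto
  moreover have "proj s (of_real s *\<^sub>C v - e) = 0"
    by (simp add: proj_def cinner_diff_right cinner_scaleC_right)
  ultimately show "\<exists>x. x \<noteq> 0 \<and> proj s x = 0" by blast
  have "v \<noteq> 0" using norm_v by auto
  moreover have "proj s v = v" by (simp add: proj_def)
  ultimately show "\<exists>x. x \<noteq> 0 \<and> proj s x = x" by blast
qed

text \<open>The triangular form in the orthonormal basis \<open>v\<close>, \<open>e\<close>. Its
  off-diagonal entry \<open>s * (b - a)\<close> turns into the block \<open>s (W - Z)\<close> when
  the entries of the polynomial matrix are evaluated.\<close>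

lemma D_proj:
  "idempotent_op.D (proj s) a b x =
     (b * cinner v x + s * ((b - a) * cinner e x)) *\<^sub>C v + (a * cinner e x) *\<^sub>C e + a *\<^sub>C rest x"
proof -
  have "a *\<^sub>C x = (a * cinner v x) *\<^sub>C v + (a * cinner e x) *\<^sub>C e + a *\<^sub>C rest x"
    using arg_cong[OF decompose[of x], of "\<lambda>x. a *\<^sub>C x"] by (simp only: scaleC_add_right scaleC_scaleC)
  then show ?thesis
    by (simp add: D_def proj_def scaleC_simps algebra_simps)
qed

end

section \<open>The operator matrix\<close>

lemma norm_vec_square: "(norm (x :: 'a::real_normed_vector ^ 'n))\<^sup>2 = (\<Sum>i\<in>UNIV. (norm (x $ i))\<^sup>2)"
  by (simp add: norm_vec_def L2_set_def sum_nonneg)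

lemma scaleR_matrix_vector_mult:
  fixes A :: "complex ^ 'r ^ 's"
  shows "(c *\<^sub>R A) *v x = c *\<^sub>R (A *v x)"
  by (simp add: vec_eq_iff matrix_vector_mult_def scaleR_sum_right)

text \<open>The squared norm of \<open>M\<close> acting on tuples of vectors depends only on, and is
  additive in, \<open>mat_adjoint M ** M\<close>. So two matrices whose Gram matrices add up to the
  identity have squared norms adding up to that of the tuple.\<close>

lemma gram_sum:
  fixes M :: "complex ^ 'r ^ 's" and r :: "'r \<Rightarrow> 'h::complex_hilbert"
  shows "complex_of_real (\<Sum>i\<in>UNIV. (norm (\<Sum>j\<in>UNIV. M $ i $ j *\<^sub>C r j))\<^sup>2)
    = (\<Sum>j\<in>UNIV. \<Sum>k\<in>UNIV. (mat_adjoint M ** M) $ j $ k * cinner (r j) (r k))"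
proof -
  have "complex_of_real (\<Sum>i\<in>UNIV. (norm (\<Sum>j\<in>UNIV. M $ i $ j *\<^sub>C r j))\<^sup>2)
      = (\<Sum>i\<in>UNIV. \<Sum>j\<in>UNIV. \<Sum>k\<in>UNIV. cnj (M $ i $ j) * M $ i $ k * cinner (r j) (r k))"
    unfolding of_real_sum cinner_self[symmetric]
    unfolding cinner_sum_left unfolding cinner_sum_right
    by (simp add: cinner_scaleC_left cinner_scaleC_right mult_ac)
  also have "\<dots> = (\<Sum>j\<in>UNIV. \<Sum>k\<in>UNIV. \<Sum>i\<in>UNIV. cnj (M $ i $ j) * M $ i $ k * cinner (r j) (r k))"
    by (subst sum.swap) (intro sum.cong refl sum.swap)
  also have "\<dots> = (\<Sum>j\<in>UNIV. \<Sum>k\<in>UNIV. (mat_adjoint M ** M) $ j $ k * cinner (r j) (r k))"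
    by (simp add: matrix_matrix_mult_def mat_adjoint_def sum_distrib_right)
  finally show ?thesis .
qed

text \<open>Writing \<open>I - A\<^sup>* A = S\<^sup>* S\<close>, the difference of the two sides is a sum of squares.\<close>

lemma matrix_norm_hilbert_less_1:
  fixes A :: "complex ^ 'r ^ 's" and r :: "'r \<Rightarrow> 'h::complex_hilbert"
  assumes "matrix_norm A < 1"
  shows "(\<Sum>i\<in>UNIV. (norm (\<Sum>j\<in>UNIV. A $ i $ j *\<^sub>C r j))\<^sup>2) \<le> (\<Sum>j\<in>UNIV. (norm (r j))\<^sup>2)"
    (is "?A \<le> ?r")
proof -
  define S where "S = mat_sqrt (mat 1 - mat_adjoint A ** A)"
  have less: "matrix_norm (mat_adjoint A ** A) < 1"
    using assms by (intro matrix_norm_mult_less_1) auto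
  have S: "mat_adjoint S ** S = mat 1 - mat_adjoint A ** A"
    using mat_sqrt_one_minus(1,2)[OF mat_adjoint_gram(2) less] by (simp add: S_def)
  let ?S = "\<Sum>i\<in>UNIV. (norm (\<Sum>j\<in>UNIV. S $ i $ j *\<^sub>C r j))\<^sup>2"
  have "complex_of_real (?A + ?S) = (\<Sum>j\<in>UNIV. \<Sum>k\<in>UNIV. (mat 1 :: complex ^ 'r ^ 'r) $ j $ k * cinner (r j) (r k))"
    by (simp only: of_real_add gram_sum S) (simp add: left_diff_distrib sum_subtractf)
  also have "\<dots> = (\<Sum>j\<in>UNIV. cinner (r j) (r j))"
    by (simp add: mat_def if_distrib[of "\<lambda>x. x * _"] cong: if_cong)
  also have "\<dots> = complex_of_real ?r"
    by (simp add: cinner_self)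
  finally have "?A + ?S = ?r" by (simp only: of_real_eq_iff)
  moreover have "0 \<le> ?S" by (simp add: sum_nonneg)
  ultimately show ?thesis by linarith
qed

lemma matrix_norm_hilbert:
  fixes A :: "complex ^ 'r ^ 's" and r :: "'r \<Rightarrow> 'h::complex_hilbert"
  assumes c: "matrix_norm A < c"
  shows "(\<Sum>i\<in>UNIV. (norm (\<Sum>j\<in>UNIV. A $ i $ j *\<^sub>C r j))\<^sup>2) \<le> c\<^sup>2 * (\<Sum>j\<in>UNIV. (norm (r j))\<^sup>2)"
proof -
  have "c > 0" using c matrix_norm_nonneg[of A] by linarith
  define A' where "A' = (1 / c) *\<^sub>R A"
  have "matrix_norm A' < 1"
    unfolding matrix_norm_def
  proof (rule onorm_less_1I)
    fix x :: "complex ^ 'r" assume "x \<noteq> 0"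
    have "norm (A *v x) \<le> matrix_norm A * norm x" by (rule matrix_norm_apply)
    also have "\<dots> < c * norm x" using c \<open>x \<noteq> 0\<close> by simp
    finally have "norm (A *v x) < c * norm x" .
    moreover have "A' *v x = (1 / c) *\<^sub>R (A *v x)"
      by (simp add: A'_def scaleR_matrix_vector_mult)
    ultimately show "norm (A' *v x) < norm x"
      using \<open>c > 0\<close> by (simp add: field_simps)
  qed simp
  from matrix_norm_hilbert_less_1[OF this, of "\<lambda>j. of_real c *\<^sub>C r j"]
  show ?thesis
    using \<open>c > 0\<close> by (simp add: A'_def scaleC_scaleC norm_scaleC power_mult_distrib scaleR_conv_of_real[where 'a = complex] sum_distrib_left)
qed

context orthonormal_pair
begin

text \<open>Tuples split orthogonally into their \<open>v\<close>- and \<open>e\<close>-components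
  and the rest. The first two form a pair of complex vectors on which the block matrix acts with
  constant \<open>k < 1\<close>; on the rest \<open>Z\<close> acts entrywise with constant
  \<open>c < 1\<close>.\<close>

lemma onorm_op_matrix_less_1:
  fixes \<delta> :: "('d::finite cpoly) ^ 'r ^ 's" and z w :: "complex ^ 'd"
  assumes z: "z \<in> B_dom \<delta>" and w: "w \<in> B_dom \<delta>"
    and \<rho>: "d_delta \<delta> z w < \<rho>" "\<rho> < 1" and s: "s\<^sup>2 = (1 - \<rho>\<^sup>2) / \<rho>\<^sup>2"
  shows "onorm (op_matrix \<delta> (\<lambda>j. idempotent_op.D (proj s) (z $ j) (w $ j))) < 1"
proof -
  define Z W where "Z = cpmat_eval \<delta> z" and "W = cpmat_eval \<delta> w"
  have Z: "matrix_norm Z < 1" and W: "matrix_norm W < 1"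
    using z w by (simp_all add: B_dom_def Z_def W_def)
  have \<rho>': "matrix_norm (moebius_mat W Z) < \<rho>"
    using \<rho> by (simp add: d_delta_moebius_mat Z_def W_def)
  obtain k where k: "0 \<le> k" "k < 1" "\<And>x y. (norm (W *v x + s *\<^sub>R ((W - Z) *v y)))\<^sup>2 + (norm (Z *v y))\<^sup>2
      \<le> k\<^sup>2 * ((norm x)\<^sup>2 + (norm y)\<^sup>2)"
    using moebius_mat_block_contraction[OF Z W \<rho>' \<rho>(2) s] by blast
  obtain c where c: "matrix_norm Z < c" "c < 1" using dense[OF Z] by blast
  have "0 \<le> c" using c matrix_norm_nonneg[of Z] by linarith
  define K where "K = max k c"
  have K: "0 \<le> K" "K < 1" "k\<^sup>2 \<le> K\<^sup>2" "c\<^sup>2 \<le> K\<^sup>2"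
    using k c \<open>0 \<le> c\<close> by (auto simp: K_def intro!: power_mono)
  let ?T = "\<lambda>j. idempotent_op.D (proj s) (z $ j) (w $ j)"
  have "norm (op_matrix \<delta> ?T x) \<le> K * norm x" for x
  proof -
    define a where "a = (\<chi> j. cinner v (x $ j))"
    define b where "b = (\<chi> j. cinner e (x $ j))"
    define A where "A = W *v a + s *\<^sub>R ((W - Z) *v b)"
    define B where "B = Z *v b"
    define R where "R i = (\<Sum>j\<in>UNIV. Z $ i $ j *\<^sub>C rest (x $ j))" for i
    have "op_matrix \<delta> ?T x $ i = (A $ i) *\<^sub>C v + (B $ i) *\<^sub>C e + R i" for i
    proof -
      have "op_matrix \<delta> ?T x $ i = (\<Sum>j\<in>UNIV. idempotent_op.D (proj s) (Z $ i $ j) (W $ i $ j) (x $ j))"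
        by (simp add: op_matrix_def op_poly_D Z_def W_def cpmat_eval_def)
      also have "\<dots> = (\<Sum>j\<in>UNIV. (W $ i $ j * a $ j + s * ((W $ i $ j - Z $ i $ j) * b $ j)) *\<^sub>C v)
          + (\<Sum>j\<in>UNIV. (Z $ i $ j * b $ j) *\<^sub>C e) + R i"
        by (simp add: D_proj a_def b_def R_def sum.distrib)
      also have "(\<Sum>j\<in>UNIV. (W $ i $ j * a $ j + s * ((W $ i $ j - Z $ i $ j) * b $ j)) *\<^sub>C v) = (A $ i) *\<^sub>C v"
        by (simp add: A_def matrix_vector_mult_def scaleC_sum_left[symmetric] sum.distrib
            sum_distrib_left scaleR_conv_of_real[where 'a = complex])
      also have "(\<Sum>j\<in>UNIV. (Z $ i $ j * b $ j) *\<^sub>C e) = (B $ i) *\<^sub>C e"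
        by (simp add: B_def matrix_vector_mult_def scaleC_sum_left[symmetric])
      finally show ?thesis .
    qed
    then have "(norm (op_matrix \<delta> ?T x $ i))\<^sup>2 = (cmod (A $ i))\<^sup>2 + (cmod (B $ i))\<^sup>2 + (norm (R i))\<^sup>2" for i
      by (simp add: norm_square_decomposed R_def cinner_sum_right cinner_scaleC_right)
    then have "(norm (op_matrix \<delta> ?T x))\<^sup>2 = ((norm A)\<^sup>2 + (norm B)\<^sup>2) + (\<Sum>i\<in>UNIV. (norm (R i))\<^sup>2)"
      by (simp add: norm_vec_square sum.distrib)
    also have "\<dots> \<le> K\<^sup>2 * ((norm a)\<^sup>2 + (norm b)\<^sup>2) + K\<^sup>2 * (\<Sum>j\<in>UNIV. (norm (rest (x $ j)))\<^sup>2)"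
    proof (rule add_mono)
      have "(norm A)\<^sup>2 + (norm B)\<^sup>2 \<le> k\<^sup>2 * ((norm a)\<^sup>2 + (norm b)\<^sup>2)"
        unfolding A_def B_def by (rule k(3))
      also have "\<dots> \<le> K\<^sup>2 * ((norm a)\<^sup>2 + (norm b)\<^sup>2)"
        by (intro mult_right_mono K) simp
      finally show "(norm A)\<^sup>2 + (norm B)\<^sup>2 \<le> K\<^sup>2 * ((norm a)\<^sup>2 + (norm b)\<^sup>2)" .
      have "(\<Sum>i\<in>UNIV. (norm (R i))\<^sup>2) \<le> c\<^sup>2 * (\<Sum>j\<in>UNIV. (norm (rest (x $ j)))\<^sup>2)"
        unfolding R_def by (rule matrix_norm_hilbert[OF c(1)])
      also have "\<dots> \<le> K\<^sup>2 * (\<Sum>j\<in>UNIV. (norm (rest (x $ j)))\<^sup>2)"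
        by (intro mult_right_mono K) (simp add: sum_nonneg)
      finally show "(\<Sum>i\<in>UNIV. (norm (R i))\<^sup>2) \<le> K\<^sup>2 * (\<Sum>j\<in>UNIV. (norm (rest (x $ j)))\<^sup>2)" .
    qed
    also have "\<dots> = (K * norm x)\<^sup>2"
      unfolding power_mult_distrib norm_vec_square norm_square_decompose[of "x $ _"]
      by (simp add: a_def b_def sum.distrib distrib_left)
    finally show ?thesis
      by (rule power2_le_imp_le) (simp add: K)
  qed
  then have "onorm (op_matrix \<delta> ?T) \<le> K"
    using K by (intro onorm_bound)
  with K show ?thesis by simp
qed

end

section \<open>The scalar case\<close>

lemma moebius_identity:
  "(cmod (1 - cnj b * a))\<^sup>2 = (cmod (a - b))\<^sup>2 + (1 - (cmod a)\<^sup>2) * (1 - (cmod b)\<^sup>2)"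
  by (simp add: cmod_power2) (simp add: power2_eq_square algebra_simps)

text \<open>Where the denominator vanishes, division by zero makes \<open>d_disk\<close> equal to 0,
  so the bound persists.\<close>

lemma d_disk_leI:
  assumes "0 \<le> \<rho>" "cmod (a - b) \<le> \<rho> * cmod (1 - cnj b * a)"
  shows "d_disk a b \<le> \<rho>"
  using assms by (cases "1 - cnj b * a = 0") (auto simp: d_disk_def norm_divide divide_simps)

lemma d_disk_le_1:
  assumes "cmod a \<le> 1" "cmod b \<le> 1"
  shows "d_disk a b \<le> 1"
proof (rule d_disk_leI)
  have "0 \<le> (1 - (cmod a)\<^sup>2) * (1 - (cmod b)\<^sup>2)"
    using assms by (simp add: abs_square_le_1)
  then have "(cmod (a - b))\<^sup>2 \<le> (cmod (1 - cnj b * a))\<^sup>2"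
    by (simp add: moebius_identity)
  then show "cmod (a - b) \<le> 1 * cmod (1 - cnj b * a)"
    by (auto intro: power2_le_imp_le)
qed simp

text \<open>The converse of the block estimate for 1 by 1 matrices:
  \<open>1 + s ^ 2 = 1 / \<rho> ^ 2\<close> combines with \<open>moebius_identity\<close>. The case
  of unimodular \<open>b\<close> has to be included because a member of the class may be a
  unimodular constant.\<close>

lemma d_disk_le_if_contraction:
  fixes a b :: complex and \<rho> s :: real
  assumes \<rho>: "0 < \<rho>" "\<rho> < 1" and s: "s\<^sup>2 = (1 - \<rho>\<^sup>2) / \<rho>\<^sup>2"
    and contr: "\<And>x y. (cmod (b * x + s * ((b - a) * y)))\<^sup>2 + (cmod (a * y))\<^sup>2 \<le> (cmod x)\<^sup>2 + (cmod y)\<^sup>2"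
  shows "d_disk a b \<le> \<rho>"
proof -
  define q where "q = s * (b - a)"
  have s': "1 + s\<^sup>2 = 1 / \<rho>\<^sup>2" using \<rho> by (simp add: s field_simps)
  have q2: "(cmod q)\<^sup>2 = s\<^sup>2 * (cmod (a - b))\<^sup>2"
    by (simp add: q_def norm_mult power_mult_distrib norm_minus_commute)
  have contr': "(cmod (b * x + q * y))\<^sup>2 + (cmod (a * y))\<^sup>2 \<le> (cmod x)\<^sup>2 + (cmod y)\<^sup>2" for x y
    using contr[of x y] by (simp add: q_def mult.assoc)
  have b1: "(cmod b)\<^sup>2 \<le> 1" using contr'[of 1 0] by simp
  show ?thesis
  proof (cases "(cmod b)\<^sup>2 = 1")
    case True
    then have bb: "b * cnj b = 1" by (simp add: complex_norm_square[symmetric])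
    have "q = 0"
    proof (rule ccontr)
      assume "q \<noteq> 0"
      \<comment> \<open>For unimodular \<open>b\<close> no finite \<open>x\<close> is optimal. This
        \<open>n\<close> gives \<open>(n + 1) ^ 2 - n ^ 2\<close>, times the squared modulus of
        \<open>q\<close>, a value of at least 2, whereas contractivity allows at most 1.\<close>
      define n where "n = 1 / (cmod q)\<^sup>2"
      have "b * (n * (cnj b * q)) + q * 1 = of_real (n + 1) * q"
        using bb by (simp add: algebra_simps)
      then have "(cmod (of_real (n + 1) * q))\<^sup>2 + (cmod a)\<^sup>2 \<le> (cmod (n * (cnj b * q)))\<^sup>2 + 1"
        using contr'[of "n * (cnj b * q)" 1] by simp
      then have "(n + 1)\<^sup>2 * (cmod q)\<^sup>2 \<le> n\<^sup>2 * (cmod q)\<^sup>2 + 1"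
        using True by (simp add: norm_mult power_mult_distrib del: of_real_add)
          (smt (verit) zero_le_power2)
      moreover have "n * (cmod q)\<^sup>2 = 1" using \<open>q \<noteq> 0\<close> by (simp add: n_def)
      then have "(n + 1)\<^sup>2 * (cmod q)\<^sup>2 = n\<^sup>2 * (cmod q)\<^sup>2 + 2 + (cmod q)\<^sup>2"
        by (simp add: power2_eq_square algebra_simps)
      moreover have "0 \<le> (cmod q)\<^sup>2" by simp
      ultimately show False by linarith
    qed
    then have "s = 0 \<or> a = b" by (auto simp: q_def)
    moreover have "s \<noteq> 0" using s \<rho> by (auto simp: power_strict_mono abs_square_eq_1 power2_eq_1_iff)
    ultimately have "a = b" by simp
    then show ?thesis using \<rho> by (simp add: d_disk_def)
  next
    case False
    \<comment> \<open>The test vector will be \<open>(cnj b * q, \<beta>)\<close>, a multiple of the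
      maximiser \<open>(cnj b * q / \<beta>, 1)\<close> from completing the square; with it
      \<open>b * x + q * y\<close> collapses to \<open>q\<close>.\<close>
    define \<beta> where "\<beta> = 1 - (cmod b)\<^sup>2"
    have \<beta>: "\<beta> > 0" using False b1 by (simp add: \<beta>_def)
    have "complex_of_real \<beta> = 1 - b * cnj b"
      unfolding \<beta>_def of_real_diff complex_norm_square by simp
    then have "b * (cnj b * q) + q * \<beta> = q"
      by (simp only:) (simp add: algebra_simps)
    then have "(cmod q)\<^sup>2 + (cmod a)\<^sup>2 * \<beta>\<^sup>2 \<le> (cmod b)\<^sup>2 * (cmod q)\<^sup>2 + \<beta>\<^sup>2"
      using contr'[of "cnj b * q" \<beta>] by (simp add: norm_mult power_mult_distrib)
    then have "\<beta> * (cmod q)\<^sup>2 \<le> \<beta> * ((1 - (cmod a)\<^sup>2) * \<beta>)"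
      by (simp add: \<beta>_def power2_eq_square algebra_simps)
    then have "(cmod q)\<^sup>2 \<le> (1 - (cmod a)\<^sup>2) * \<beta>"
      using \<beta> by simp
    then have "(1 + s\<^sup>2) * (cmod (a - b))\<^sup>2 \<le> (cmod (1 - cnj b * a))\<^sup>2"
      unfolding moebius_identity by (simp add: q2 \<beta>_def algebra_simps)
    then have "(cmod (a - b))\<^sup>2 \<le> (\<rho> * cmod (1 - cnj b * a))\<^sup>2"
      unfolding s' using \<rho> by (simp add: power_mult_distrib field_simps)
    then have "cmod (a - b) \<le> \<rho> * cmod (1 - cnj b * a)"
      by (rule power2_le_imp_le) (use \<rho> in simp)
    then show ?thesis using \<rho> by (intro d_disk_leI) auto
  qed
qed

section \<open>The domain\<close>

lemma holomorphic_fun_cpoly_eval: "cpoly_eval p \<in> holomorphic_fun U"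
  unfolding cpoly_eval_def[abs_def] by (intro holomorphic_fun_intros)

lemma continuous_on_matrix_norm: "continuous_on UNIV (matrix_norm :: complex ^ 'r ^ 's \<Rightarrow> real)"
proof -
  define g where "g A = Blinfun ((*v) A)" for A :: "complex ^ 'r ^ 's"
  have g: "blinfun_apply (g A) = (*v) A" for A
    unfolding g_def by (rule bounded_linear_Blinfun_apply) simp
  have "linear g"
    by (rule linearI; rule blinfun_eqI)
       (simp_all add: g blinfun.add_left blinfun.scaleR_left matrix_vector_mult_add_rdistrib scaleR_matrix_vector_mult)
  then have "continuous_on UNIV (\<lambda>A. norm (g A))"
    by (intro continuous_on_norm linear_continuous_on) (simp add: linear_conv_bounded_linear)
  moreover have "norm (g A) = matrix_norm A" for A
    by (simp add: norm_blinfun.rep_eq g matrix_norm_def)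
  ultimately show ?thesis by simp
qed

lemma open_B_dom: "open (B_dom \<delta>)"
proof -
  have "continuous_on UNIV (\<lambda>z. cpmat_eval \<delta> z)"
    unfolding cpmat_eval_def
    by (intro continuous_on_vec_lambda holomorphic_fun_continuous_on[OF holomorphic_fun_cpoly_eval])
  then have "continuous_on UNIV (\<lambda>z. matrix_norm (cpmat_eval \<delta> z))"
    by (rule continuous_on_compose2[OF continuous_on_matrix_norm]) simp
  then show ?thesis
    unfolding B_dom_def by (intro open_Collect_less continuous_on_const)
qed

section \<open>The two inequalities\<close>

lemma d_disk_le_d_delta:
  fixes \<delta> :: "('d::finite cpoly) ^ 'r ^ 's"
  assumes H: "separable_infinite_dim TYPE('h::complex_hilbert)"
    and f: "f \<in> schur_agler TYPE('h) \<delta>"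
    and z: "z \<in> B_dom \<delta>" and w: "w \<in> B_dom \<delta>"
  shows "d_disk (f z) (f w) \<le> d_delta \<delta> z w"
proof (cases "z = w")
  case True
  then show ?thesis by (simp add: d_disk_def d_delta_moebius_mat)
next
  case False
  obtain v e :: 'h where "norm v = 1" "norm e = 1" "cinner v e = 0"
    using exists_orthonormal_pair[OF H] .
  then interpret orthonormal_pair v e by unfold_locales
  have "d_delta \<delta> z w < 1"
    using z w by (simp add: d_delta_moebius_mat B_dom_def matrix_norm_moebius_mat_less_1)
  then show ?thesis
  \<comment> \<open>It suffices to bound by every \<rho> strictly between
    \<open>d_delta \<delta> z w\<close> and 1; the strictness on the left makes the operator matrix
    a strict contraction.\<close>
  proof (rule dense_ge_bounded)
    fix \<rho> assume \<rho>: "d_delta \<delta> z w < \<rho>" "\<rho> < 1"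
    have "0 \<le> d_delta \<delta> z w" by (simp add: d_delta_moebius_mat)
    with \<rho> have "0 < \<rho>" by linarith
    define s where "s = sqrt ((1 - \<rho>\<^sup>2) / \<rho>\<^sup>2)"
    have s: "s\<^sup>2 = (1 - \<rho>\<^sup>2) / \<rho>\<^sup>2"
      using \<open>0 < \<rho>\<close> \<rho>(2) by (simp add: s_def abs_square_le_1 power_le_one)
    let ?T = "\<lambda>j. idempotent_op.D (proj s) (z $ j) (w $ j)"
    have "onorm (taylor_fc ?T (B_dom \<delta>) f) \<le> 1"
      using f commuting_tuple_D onorm_op_matrix_less_1[OF z w \<rho> s] unfolding schur_agler_def by blast
    moreover have "taylor_fc ?T (B_dom \<delta>) f = idempotent_op.D (proj s) (f z) (f w)"
      using f z w by (intro taylor_fc_D False open_B_dom) (auto simp: schur_agler_def)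
    ultimately have on: "onorm (idempotent_op.D (proj s) (f z) (f w)) \<le> 1" by simp
    have contr: "norm (idempotent_op.D (proj s) (f z) (f w) x) \<le> norm x" for x
    proof -
      have "norm (idempotent_op.D (proj s) (f z) (f w) x) \<le> onorm (idempotent_op.D (proj s) (f z) (f w)) * norm x"
        using bounded_op_D by (intro onorm) (simp add: bounded_op_def)
      also have "\<dots> \<le> 1 * norm x" by (intro mult_right_mono on) simp
      finally show ?thesis by simp
    qed
    show "d_disk (f z) (f w) \<le> \<rho>"
    proof (rule d_disk_le_if_contraction[OF \<open>0 < \<rho>\<close> \<rho>(2) s])
      fix x y
      let ?u = "x *\<^sub>C v + y *\<^sub>C e"
      have u: "cinner v ?u = x" "cinner e ?u = y"
        by (simp_all add: cinner_add_right cinner_scaleC_right)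
      have "rest ?u = 0" by (simp add: rest_def u)
      then have "(norm (idempotent_op.D (proj s) (f z) (f w) ?u))\<^sup>2
          = (cmod (f w * x + s * ((f w - f z) * y)))\<^sup>2 + (cmod (f z * y))\<^sup>2"
        unfolding D_proj u using norm_square_decomposed[of 0] by simp
      moreover have "(norm ?u)\<^sup>2 = (cmod x)\<^sup>2 + (cmod y)\<^sup>2"
        using norm_square_decomposed[of 0 x y] by simp
      moreover have "(norm (idempotent_op.D (proj s) (f z) (f w) ?u))\<^sup>2 \<le> (norm ?u)\<^sup>2"
        using contr by (simp add: power_mono)
      ultimately show "(cmod (f w * x + s * ((f w - f z) * y)))\<^sup>2 + (cmod (f z * y))\<^sup>2
          \<le> (cmod x)\<^sup>2 + (cmod y)\<^sup>2" by simp
    qed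
  qed
qed

section \<open>Holomorphic matrix coefficients and the right inequality\<close>

lemma holomorphic_fun_det:
  assumes "\<And>i j. (\<lambda>z. A z $ i $ j) \<in> holomorphic_fun U"
  shows "(\<lambda>z. det (A z)) \<in> holomorphic_fun U"
  unfolding det_def by (intro holomorphic_fun_intros assms)

lemma holomorphic_fun_matrix_vector_mult:
  assumes "\<And>i j. (\<lambda>z. A z $ i $ j) \<in> holomorphic_fun U" "\<And>i. (\<lambda>z. x z $ i) \<in> holomorphic_fun U"
  shows "(\<lambda>z. (A z *v x z) $ i) \<in> holomorphic_fun U"
  unfolding matrix_vector_mult_def vec_lambda_beta by (intro holomorphic_fun_intros assms)

text \<open>Cramer's rule writes each component as a quotient of determinants, with nonvanishing
  denominator.\<close>

lemma holomorphic_fun_matrix_inv: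
  fixes A :: "complex ^ 'd \<Rightarrow> complex ^ 'n ^ 'n"
  assumes U: "open U" and A: "\<And>i j. (\<lambda>z. A z $ i $ j) \<in> holomorphic_fun U"
    and inv: "\<And>z. z \<in> U \<Longrightarrow> invertible (A z)"
  shows "(\<lambda>z. (matrix_inv (A z) *v b) $ k) \<in> holomorphic_fun U"
proof (rule holomorphic_fun_cong[OF U])
  have det: "det (A z) \<noteq> 0" if "z \<in> U" for z
    using inv[OF that] by (simp add: invertible_det_nz)
  have "(\<lambda>z. (\<chi> i j. if j = k then b $ i else A z $ i $ j) $ i $ j) \<in> holomorphic_fun U" for i j
    by (cases "j = k") (simp_all add: A holomorphic_fun_const)
  then show "(\<lambda>z. det (\<chi> i j. if j = k then b $ i else A z $ i $ j) / det (A z)) \<in> holomorphic_fun U"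
    by (intro holomorphic_fun_divide holomorphic_fun_det A det)
  fix z assume "z \<in> U"
  from cramer[OF det[OF this], of "matrix_inv (A z) *v b" b] matrix_inv_vec(2)[OF inv[OF this], of b]
  show "det (\<chi> i j. if j = k then b $ i else A z $ i $ j) / det (A z) = (matrix_inv (A z) *v b) $ k"
    by (metis (no_types, lifting) vec_lambda_beta)
qed

lemma cmod_sum_cnj_mult_le:
  "cmod (\<Sum>i\<in>UNIV. cnj (y $ i) * x $ i) \<le> norm y * norm (x :: complex ^ 'n)"
proof -
  have "cmod (\<Sum>i\<in>UNIV. cnj (y $ i) * x $ i) \<le> (\<Sum>i\<in>UNIV. \<bar>cmod (y $ i)\<bar> * \<bar>cmod (x $ i)\<bar>)"
    by (rule order_trans[OF norm_sum]) (simp add: norm_mult)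
  also have "\<dots> \<le> norm y * norm x"
    unfolding norm_vec_def by (rule L2_set_mult_ineq)
  finally show ?thesis .
qed

lemma d_delta_le_d_moebius:
  fixes \<delta> :: "('d::finite cpoly) ^ 'r ^ 's"
  assumes z: "z \<in> B_dom \<delta>" and w: "w \<in> B_dom \<delta>"
  shows "d_delta \<delta> z w \<le> d_moebius (B_dom \<delta>) z w"
proof -
  define U where "U = B_dom \<delta>"
  define W where "W = cpmat_eval \<delta> w"
  define M where "M \<zeta> = moebius_mat W (cpmat_eval \<delta> \<zeta>)" for \<zeta>
  have W: "matrix_norm W < 1" using w by (simp add: B_dom_def W_def)
  have less: "matrix_norm (cpmat_eval \<delta> \<zeta>) < 1" if "\<zeta> \<in> U" for \<zeta>
    using that by (simp add: B_dom_def U_def)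
  have M1: "matrix_norm (M \<zeta>) < 1" if "\<zeta> \<in> U" for \<zeta>
    unfolding M_def by (rule matrix_norm_moebius_mat_less_1[OF less[OF that] W])
  obtain x where x: "norm x = 1" "norm (M z *v x) = matrix_norm (M z)"
    using onorm_attained[of "(*v) (M z)"] unfolding matrix_norm_def by auto
  define n where "n = norm (M z *v x)"
  \<comment> \<open>The unit vector in the direction of the extremal image. If \<open>n = 0\<close>,
    division by zero makes \<open>y\<close> the zero vector, and \<open>g z = n\<close> still
    holds.\<close>
  define y where "y = (1 / n) *\<^sub>R (M z *v x)"
  have y: "norm y \<le> 1" by (simp add: y_def n_def)
  define g where "g \<zeta> = (\<Sum>i\<in>UNIV. cnj (y $ i) * (M \<zeta> *v x) $ i)" for \<zeta>
  have gz: "g z = of_real n"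
  proof -
    have "g z = of_real (1 / n) * (\<Sum>i\<in>UNIV. of_real ((cmod ((M z *v x) $ i))\<^sup>2))"
      unfolding g_def y_def sum_distrib_left complex_norm_square
      by  (simp add: scaleR_conv_of_real[where 'a = complex] mult_ac)
    also have "\<dots> = of_real ((1 / n) * n\<^sup>2)"
      by (simp add: n_def norm_vec_square)
    finally show ?thesis by (simp add: power2_eq_square)
  qed
  have "M w = 0"
    by (simp add: M_def moebius_mat_def W_def matrix_eq matrix_vector_mul_assoc[symmetric])
  then have gw: "g w = 0" by (simp add: g_def)
  have gball: "g ` U \<subseteq> ball 0 1"
  proof safe
    fix \<zeta> assume \<zeta>: "\<zeta> \<in> U"
    have "cmod (g \<zeta>) \<le> norm y * norm (M \<zeta> *v x)"
      unfolding g_def by (rule cmod_sum_cnj_mult_le)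
    also have "\<dots> \<le> 1 * norm (M \<zeta> *v x)" by (intro mult_right_mono y) simp
    also have "\<dots> < 1" using matrix_norm_less_1D[OF M1[OF \<zeta>], of x] x(1) by force
    finally show "g \<zeta> \<in> ball 0 1" by simp
  qed
  \<comment> \<open>The variable enters only through \<open>cpmat_eval \<delta> \<zeta> - W\<close>
    and \<open>matrix_inv (mat 1 - mat_adjoint W ** cpmat_eval \<delta> \<zeta>)\<close>; both
    square roots depend on \<open>W\<close> alone.\<close>
  have "g \<in> holomorphic_fun U"
  proof -
    have \<delta>: "(\<lambda>\<zeta>. cpmat_eval \<delta> \<zeta> $ i $ j) \<in> holomorphic_fun U" for i j
      by (simp add: cpmat_eval_def holomorphic_fun_cpoly_eval)
    have \<delta>': "(\<lambda>\<zeta>. (mat 1 - mat_adjoint W ** cpmat_eval \<delta> \<zeta>) $ i $ j) \<in> holomorphic_fun U" for i j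
      by (simp add: matrix_matrix_mult_def) (intro holomorphic_fun_intros \<delta>)
    have inv: "invertible (mat 1 - mat_adjoint W ** cpmat_eval \<delta> \<zeta>)" if "\<zeta> \<in> U" for \<zeta>
      using W less[OF that] by (intro invertible_one_minus matrix_norm_mult_less_1) auto
    have \<delta>'': "(\<lambda>\<zeta>. (cpmat_eval \<delta> \<zeta> - W) $ i $ j) \<in> holomorphic_fun U" for i j
      by simp (intro holomorphic_fun_intros \<delta>)
    have "open U" unfolding U_def by (rule open_B_dom)
    show ?thesis
      unfolding g_def M_def moebius_mat_def matrix_vector_mul_assoc[symmetric]
      by (intro holomorphic_fun_sum holomorphic_fun_mult holomorphic_fun_matrix_vector_mult
          holomorphic_fun_const holomorphic_fun_matrix_inv \<open>open U\<close> \<delta>' \<delta>'' inv)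
  qed
  have "d_delta \<delta> z w = d_disk (g z) (g w)"
    using x by (simp add: gz gw d_disk_def d_delta_moebius_mat M_def W_def n_def)
  also have "\<dots> \<le> d_moebius U z w"
    unfolding d_moebius_def
  proof (rule cSup_upper)
    show "bdd_above {d_disk (f z) (f w) |f. f \<in> holomorphic_fun U \<and> f ` U \<subseteq> ball 0 1}"
      using z w unfolding U_def by (intro bdd_aboveI[of _ 1]) (force intro: d_disk_le_1)
  qed (use \<open>g \<in> holomorphic_fun U\<close> gball in blast)
  finally show ?thesis by (simp add: U_def)
qed

theorem mainTheorem4:
  fixes \<delta> :: "('d::finite cpoly) ^ 'r ^ 's"
    and f :: "complex ^ 'd \<Rightarrow> complex"
    and z w :: "complex ^ 'd"
  assumes H: "separable_infinite_dim TYPE('h::complex_hilbert)"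
    and conn: "connected (B_dom \<delta>)"
    and more_than_one: "\<exists>a\<in>B_dom \<delta>. \<exists>b\<in>B_dom \<delta>. a \<noteq> b"
    and f: "f \<in> schur_agler TYPE('h) \<delta>"
    and z: "z \<in> B_dom \<delta>"
    and w: "w \<in> B_dom \<delta>"
  shows "d_disk (f z) (f w) \<le> d_delta \<delta> z w \<and> d_delta \<delta> z w \<le> d_moebius (B_dom \<delta>) z w"
  using d_disk_le_d_delta[OF H f z w] d_delta_le_d_moebius[OF z w] by blast

end
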